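(* Let $n\ge 1$ and let $k_1\le k_2\le\cdots\le k_n$ be integers. Then the generating function of weak monotone triangles with bottom row $(k_1,\ldots,k_n)$ with respect to the $P$-weight, i.e. $\sum_T w_P(T)$ over all weak monotone triangles $T$ with bottom row $(k_1,\ldots,k_n)$, equals $$P^{\binom{n+1}{3}}\prod_{1\le s<t\le n}\left({}_PE_{k_t}+{}_P\Delta_{k_s}\,{}_P\Delta_{k_t}\right)\prod_{1\le i<j\le n}\frac{P^{k_j}-P^{k_i}}{P^j-P^i},$$ where the operator is applied to the function $\prod_{1\le i<j\le n}\frac{P^{k_j}-P^{k_i}}{P^j-P^i}$ of the variables $k_1,\ldots,k_n$ and the result is evaluated at the given integers.
   Context: A Gelfand–Tsetlin pattern with $n$ rows is a triangular array of integers $(a_{i,j})_{1\le i\le j\le n}$ (row $i$ is $a_{i,i},\ldots,a_{i,n}$; row $1$ is the bottom row) with $a_{i,j}\le a_{i+1,j+1}$ for $1\le i\le j<n$ and $a_{i,j}\le a_{i-1,j}$ for $1<i\le j\le n$. A weak monotone triangle is a Gelfand–Tsetlin pattern with $a_{i,j-1}<a_{i-1,j}$ whenever $i\ne1$ and $i<j$. Its $P$-weight is $w_P(T)=\prod (P^{a_{i,j}}-[a_{i,j}=a_{i,j-1}])$, the product over all entries $a_{i,j}$ with $i\ge 2$ and $a_{i,j}<a_{i-1,j}$, where $[\cdot]$ is $1$ if the statement is true and $0$ otherwise (and it is $0$ if $a_{i,j-1}$ does not exist). $P$ is an indeterminate. With $E_x p(x)=p(x+1)$ and $\Delta_x=E_x-\mathrm{id}$,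 the $P$-difference operator is ${}_P\Delta_x=P^{-x}\Delta_x$ (i.e. ${}_P\Delta_x p(x)=P^{-x}(p(x+1)-p(x))$) and the $P$-shift operator is ${}_PE_x={}_P\Delta_x+\mathrm{id}$. Products of operators denote composition; operators in different variables commute. *)

theory Defs
  imports "HOL-Computational_Algebra.Computational_Algebra"
begin

text \<open>
  Weights and enumeration formulas live in the field of rational functions
  in the indeterminate \<open>P\<close>, since negative powers of \<open>P\<close>
  and the denominators \<open>P ^ j - P ^ i\<close> occur.
\<close>

definition indet :: "rat poly fract" where
  "indet = Fract [:0, 1:] 1"

definition tri_index :: "nat \<Rightarrow> (nat \<times> nat) set" where
  "tri_index n = {(i, j). 1 \<le> i \<and> i \<le> j \<and> j \<le> n}"

text \<open>
  Arrays are extensional functions on \<open>tri_index n\<close>, so that distinct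
  functions are distinct arrays. Row 1 is the bottom row.
\<close>

definition GT_patterns :: "nat \<Rightarrow> (nat \<times> nat \<Rightarrow> int) set" where
  "GT_patterns n = {a \<in> tri_index n \<rightarrow>\<^sub>E UNIV.
     (\<forall>i j. 1 \<le> i \<and> i \<le> j \<and> j < n \<longrightarrow> a (i, j) \<le> a (i + 1, j + 1)) \<and>
     (\<forall>i j. 1 < i \<and> i \<le> j \<and> j \<le> n \<longrightarrow> a (i, j) \<le> a (i - 1, j))}"

definition weak_monotone_triangles :: "nat \<Rightarrow> (nat \<times> nat \<Rightarrow> int) set" where
  "weak_monotone_triangles n = {a \<in> GT_patterns n.
     \<forall>i j. 1 < i \<and> i < j \<and> j \<le> n \<longrightarrow> a (i, j - 1) < a (i - 1, j)}"

definition bottom_row :: "nat \<Rightarrow> (nat \<Rightarrow> int) \<Rightarrow> (nat \<times> nat \<Rightarrow> int) \<Rightarrow> bool" where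
  "bottom_row n k a \<longleftrightarrow> (\<forall>j\<in>{1..n}. a (1, j) = k j)"

text \<open>The conjunct \<open>i < j\<close> says that the entry \<open>a (i, j - 1)\<close> exists.\<close>

definition P_weight :: "nat \<Rightarrow> (nat \<times> nat \<Rightarrow> int) \<Rightarrow> rat poly fract" where
  "P_weight n a =
     (\<Prod>(i, j)\<in>{(i, j). (i, j) \<in> tri_index n \<and> 2 \<le> i \<and> a (i, j) < a (i - 1, j)}.
        indet powi a (i, j) - of_bool (i < j \<and> a (i, j) = a (i, j - 1)))"

text \<open>
  Operators act on functions of integer variables \<open>k 1, k 2, \<dots>\<close>;
  the first argument of an operator is the index of the variable it acts on.
\<close>

type_synonym func = "(nat \<Rightarrow> int) \<Rightarrow> rat poly fract"

definition shift_op :: "nat \<Rightarrow> func \<Rightarrow> func" where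
  "shift_op i p = (\<lambda>k. p (k(i := k i + 1)))"

definition diff_op :: "nat \<Rightarrow> func \<Rightarrow> func" where
  "diff_op i p = (\<lambda>k. shift_op i p k - p k)"

definition P_diff_op :: "nat \<Rightarrow> func \<Rightarrow> func" where
  "P_diff_op i p = (\<lambda>k. indet powi (- k i) * diff_op i p k)"

definition P_shift_op :: "nat \<Rightarrow> func \<Rightarrow> func" where
  "P_shift_op i p = (\<lambda>k. P_diff_op i p k + p k)"

definition op_factor :: "nat \<Rightarrow> nat \<Rightarrow> func \<Rightarrow> func" where
  "op_factor s t p = (\<lambda>k. P_shift_op t p k + P_diff_op s (P_diff_op t p) k)"

text \<open>
  The composition of all factors with \<open>1 \<le> s < t \<le> n\<close>, in a fixed order;
  by \<open>op_factor_commute\<close> below the order is irrelevant.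
\<close>

definition op_prod :: "nat \<Rightarrow> func \<Rightarrow> func" where
  "op_prod n = foldr (\<circ>) [op_factor s t. t \<leftarrow> [1..<n+1], s \<leftarrow> [1..<t]] id"

definition vandermonde_quot :: "nat \<Rightarrow> func" where
  "vandermonde_quot n = (\<lambda>k. \<Prod>j\<in>{1..n}. \<Prod>i\<in>{1..<j}.
     (indet powi k j - indet powi k i) / (indet ^ j - indet ^ i))"

lemma P_diff_op_commute: "P_diff_op i (P_diff_op j p) = P_diff_op j (P_diff_op i p)"
proof (cases "i = j")
  case False
  then show ?thesis
    by (auto simp: P_diff_op_def diff_op_def shift_op_def fun_eq_iff fun_upd_twist algebra_simps)
qed simp

lemma P_diff_op_add:
  "P_diff_op i (\<lambda>k. p k + q k) = (\<lambda>k. P_diff_op i p k + P_diff_op i q k)"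
  by (simp add: P_diff_op_def diff_op_def shift_op_def fun_eq_iff algebra_simps)

lemma op_factor_commute: "op_factor s t \<circ> op_factor s' t' = op_factor s' t' \<circ> op_factor s t"
proof -
  have nf: "op_factor s t (op_factor s' t' p) = (\<lambda>k.
      P_diff_op t (P_diff_op t' p) k + P_diff_op t p k + P_diff_op t (P_diff_op s' (P_diff_op t' p)) k
      + P_diff_op t' p k + p k + P_diff_op s' (P_diff_op t' p) k
      + P_diff_op s (P_diff_op t (P_diff_op t' p)) k + P_diff_op s (P_diff_op t p) k
      + P_diff_op s (P_diff_op t (P_diff_op s' (P_diff_op t' p))) k)" for s t s' t' p
    unfolding op_factor_def P_shift_op_def P_diff_op_add by (simp add: algebra_simps)
  have t: "P_diff_op t (P_diff_op t' p) = P_diff_op t' (P_diff_op t p)" for p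
    by (rule P_diff_op_commute)
  have c1: "P_diff_op t (P_diff_op s' (P_diff_op t' p)) = P_diff_op s' (P_diff_op t' (P_diff_op t p))" for p
    by (metis P_diff_op_commute)
  have c2: "P_diff_op t' (P_diff_op s (P_diff_op t p)) = P_diff_op s (P_diff_op t' (P_diff_op t p))" for p
    by (metis P_diff_op_commute)
  have c3: "P_diff_op s' (P_diff_op s p) = P_diff_op s (P_diff_op s' p)" for p
    by (rule P_diff_op_commute)
  have c4: "P_diff_op s (P_diff_op t (P_diff_op s' (P_diff_op t' p)))
     = P_diff_op s (P_diff_op s' (P_diff_op t' (P_diff_op t p)))"
    "P_diff_op s' (P_diff_op t' (P_diff_op s (P_diff_op t p)))
     = P_diff_op s (P_diff_op s' (P_diff_op t' (P_diff_op t p)))" for p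
    by (simp_all only: c1 c2 c3)
  show ?thesis
    by (intro ext) (simp only: o_apply nf t c1 c2 c3 c4 add_ac)
qed

text \<open>The generating function is a sum over a finite set.\<close>

lemma GT_pattern_bounds:
  assumes "a \<in> GT_patterns n" "1 \<le> i" "i \<le> j" "j \<le> n"
  shows "a (1, j + 1 - i) \<le> a (i, j) \<and> a (i, j) \<le> a (1, j)"
  using assms(2-4)
proof (induction i arbitrary: j rule: dec_induct)
  case base
  then show ?case by simp
next
  case (step i)
  have "1 \<le> i \<and> i \<le> j - 1 \<and> j - 1 < n" "1 < i + 1 \<and> i + 1 \<le> j \<and> j \<le> n"
    using step by auto
  then have "a (i, j - 1) \<le> a (i + 1, j - 1 + 1)" "a (i + 1, j) \<le> a (i + 1 - 1, j)"
    using assms(1) unfolding GT_patterns_def by blast+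
  moreover have "j - 1 + 1 = j" "j - 1 + 1 - i = j + 1 - Suc i" "i \<le> j - 1" "j - 1 \<le> n" "i \<le> j"
    using step by auto
  ultimately show ?case
    using step.IH[of j] step.IH[of "j - 1"] step.prems by force
qed

lemma finite_tri_index: "finite (tri_index n)"
  by (rule finite_subset[of _ "{..n} \<times> {..n}"]) (auto simp: tri_index_def)

lemma finite_weak_monotone_triangles:
  "finite {a \<in> weak_monotone_triangles n. bottom_row n k a}"
proof (rule finite_subset)
  show "finite (PiE (tri_index n) (\<lambda>(i, j). {k (j + 1 - i)..k j}))"
    by (intro finite_PiE finite_tri_index) auto
  show "{a \<in> weak_monotone_triangles n. bottom_row n k a}
      \<subseteq> PiE (tri_index n) (\<lambda>(i, j). {k (j + 1 - i)..k j})"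
  proof
    fix a assume a: "a \<in> {a \<in> weak_monotone_triangles n. bottom_row n k a}"
    then have gt: "a \<in> GT_patterns n" and br: "\<And>j. 1 \<le> j \<Longrightarrow> j \<le> n \<Longrightarrow> a (1, j) = k j"
      by (auto simp: weak_monotone_triangles_def bottom_row_def)
    have "a (i, j) \<in> {k (j + 1 - i)..k j}" if "1 \<le> i" "i \<le> j" "j \<le> n" for i j
      using GT_pattern_bounds[OF gt that] br[of j] br[of "j + 1 - i"] that by auto
    moreover have "a \<in> extensional (tri_index n)"
      using gt by (auto simp: GT_patterns_def PiE_def)
    ultimately show "a \<in> PiE (tri_index n) (\<lambda>(i, j). {k (j + 1 - i)..k j})"
      by (auto simp: PiE_def Pi_def tri_index_def)
  qed
qed

end

theory Submission
  imports Defs "Jordan_Normal_Form.Determinant"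
begin

text \<open>
  Removing the bottom row \<open>k\<close> expresses the generating function for \<open>n + 1\<close> as a weighted sum of
  the one for \<open>n\<close> over the rows \<open>l\<close> interlacing with \<open>k\<close>. By induction the summand is
  \<open>\<^bsub>P\<^esub>\<Delta>\<^bsub>1\<^esub> \<dots> \<^bsub>P\<^esub>\<Delta>\<^bsub>n\<^esub> B\<close>, where \<open>B\<close> is the operator product applied to a multiple
  of \<open>det (P ^ (j * l i))\<close> with \<open>1 \<le> i, j \<le> n\<close>, so the sum telescopes to boundary terms in which each
  \<open>l j\<close> is \<open>k j\<close> or \<open>k (j + 1)\<close>. Terms with \<open>l j = l (j + 1)\<close> cancel because
  \<open>\<^bsub>P\<^esub>E\<^bsub>j\<^esub> + \<^bsub>P\<^esub>\<Delta>\<^bsub>j+1\<^esub> \<^bsub>P\<^esub>\<Delta>\<^bsub>j\<^esub>\<close> makes \<open>B\<close> antisymmetric in these variables. The remaining terms omit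
  exactly one \<open>k r\<close>; pulling the operators out, they form the expansion of a Vandermonde
  determinant along a column of ones.
\<close>

subsection \<open>Products of commuting operators\<close>

lemma P_diff_op_scale: "P_diff_op i (\<lambda>k. c * p k) = (\<lambda>k. c * P_diff_op i p k)"
  by (simp add: P_diff_op_def diff_op_def shift_op_def fun_eq_iff algebra_simps)

text \<open>Scalars do not depend on \<open>k\<close>: a factor that varies with \<open>k\<close>
  cannot be pulled out of \<open>P_diff_op\<close>.\<close>

definition linear_op :: "(func \<Rightarrow> func) \<Rightarrow> bool" where
  "linear_op F \<longleftrightarrow>
     (\<forall>p q. F (\<lambda>k. p k + q k) = (\<lambda>k. F p k + F q k)) \<and>
     (\<forall>c p. F (\<lambda>k. c * p k) = (\<lambda>k. c * F p k))"

lemma linear_op_add: "linear_op F \<Longrightarrow> F (\<lambda>k. p k + q k) = (\<lambda>k. F p k + F q k)"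
  and linear_op_scale: "linear_op F \<Longrightarrow> F (\<lambda>k. c * p k) = (\<lambda>k. c * F p k)"
  by (auto simp: linear_op_def)

lemma linear_op_P_diff_op: "linear_op (P_diff_op i)"
  by (simp add: linear_op_def P_diff_op_add P_diff_op_scale)

lemma linear_op_P_shift_op: "linear_op (P_shift_op i)"
  by (simp add: linear_op_def P_shift_op_def P_diff_op_add P_diff_op_scale algebra_simps)

lemma linear_op_op_factor: "linear_op (op_factor s t)"
  by (simp add: linear_op_def op_factor_def P_shift_op_def P_diff_op_add P_diff_op_scale algebra_simps)

lemma linear_op_fold:
  assumes "comp_fun_commute f" "\<And>x. linear_op (f x)" "finite A"
  shows "linear_op (\<lambda>p. Finite_Set.fold f p A)"
proof -
  interpret comp_fun_commute f by fact
  show ?thesis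
    using assms(3) by induction (use assms(2) in \<open>auto simp: linear_op_def\<close>)
qed

lemma linear_op_zero: "linear_op F \<Longrightarrow> F (\<lambda>k. 0) = (\<lambda>k. 0)"
  using linear_op_scale[of F 0 "\<lambda>k. 0"] by simp

lemma linear_op_sum:
  assumes "linear_op F" "finite I"
  shows "F (\<lambda>k. \<Sum>r\<in>I. c r * p r k) = (\<lambda>k. \<Sum>r\<in>I. c r * F (p r) k)"
  using assms(2)
  by induction
    (simp_all add: linear_op_zero[OF assms(1)] linear_op_add[OF assms(1)] linear_op_scale[OF assms(1)])

lemma P_shift_op_P_diff_op: "P_shift_op i (P_diff_op j p) = P_diff_op j (P_shift_op i p)"
  by (simp add: P_shift_op_def P_diff_op_add P_diff_op_commute[of i j])

lemma P_shift_op_commute: "P_shift_op i (P_shift_op j p) = P_shift_op j (P_shift_op i p)"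
  by (simp add: P_shift_op_def P_diff_op_add P_diff_op_commute[of i j] algebra_simps)

lemma op_factor_P_diff_op: "op_factor s t (P_diff_op j p) = P_diff_op j (op_factor s t p)"
  by (simp add: op_factor_def P_diff_op_add P_shift_op_P_diff_op P_diff_op_commute[of j])

lemma comp_fun_commute_P_diff_op: "comp_fun_commute P_diff_op"
  by unfold_locales (simp add: fun_eq_iff P_diff_op_commute)

lemma comp_fun_commute_P_shift_op: "comp_fun_commute P_shift_op"
  by unfold_locales (simp add: fun_eq_iff P_shift_op_commute)

lemma comp_fun_commute_op_factor: "comp_fun_commute (\<lambda>(s, t). op_factor s t)"
  by unfold_locales (auto simp: op_factor_commute)

interpretation P_diff_op: comp_fun_commute P_diff_op
  by (rule comp_fun_commute_P_diff_op)

interpretation P_shift_op: comp_fun_commute P_shift_op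
  by (rule comp_fun_commute_P_shift_op)

interpretation op_factor: comp_fun_commute "\<lambda>(s, t). op_factor s t"
  by (rule comp_fun_commute_op_factor)

text \<open>\<open>G\<close> is carried past the factors one at a time; injectivity of
  \<open>h\<close> keeps the images distinct, so that no factor is lost. With \<open>h = id\<close>
  this gives commutation with a further operator, otherwise a renaming of variables or a change of
  operator family.\<close>

lemma fold_intertwine:
  assumes "comp_fun_commute f" "comp_fun_commute g" "finite A" "inj_on h A"
    and "\<And>x q. x \<in> A \<Longrightarrow> G (f x q) = g (h x) (G q)"
  shows "G (Finite_Set.fold f p A) = Finite_Set.fold g (G p) (h ` A)"
proof -
  interpret f: comp_fun_commute f by fact
  interpret g: comp_fun_commute g by fact
  show ?thesis
    using assms(3-5) by (induction A) auto
qed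

definition index_pairs :: "nat \<Rightarrow> (nat \<times> nat) set" where
  "index_pairs n = {(s, t). 1 \<le> s \<and> s < t \<and> t \<le> n}"

lemma finite_index_pairs: "finite (index_pairs n)"
  by (rule finite_subset[of _ "{..n} \<times> {..n}"]) (auto simp: index_pairs_def)

lemma foldr_comp_eq_fold:
  assumes "comp_fun_commute f" "distinct xs"
  shows "foldr (\<circ>) (map f xs) id p = Finite_Set.fold f p (set xs)"
proof -
  interpret comp_fun_commute f by fact
  show ?thesis
    using assms(2) by (induction xs) auto
qed

text \<open>A fold over a set forgets the order of the factors, so that the index set can later be
  split, permuted and extended.\<close>

lemma op_prod_eq_fold:
  "op_prod n p = Finite_Set.fold (\<lambda>(s, t). op_factor s t) p (index_pairs n)"
proof -
  define xs where "xs = [(s, t). t \<leftarrow> [1..<n+1], s \<leftarrow> [1..<t]]"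
  have "map (\<lambda>(s, t). op_factor s t) xs = [op_factor s t. t \<leftarrow> [1..<n+1], s \<leftarrow> [1..<t]]"
    by (simp add: xs_def map_concat comp_def)
  \<comment> \<open>The blocks for distinct \<open>t\<close> are distinct lists because their
    lengths differ.\<close>
  moreover have "distinct xs"
    unfolding xs_def
    by (intro distinct_concat)
      (auto simp: distinct_map inj_on_def intro: map_inj_on dest: arg_cong[where f = length])
  moreover have "set xs = index_pairs n"
    by (force simp: xs_def index_pairs_def image_iff simp del: upt_Suc)
  ultimately show ?thesis
    using foldr_comp_eq_fold[OF comp_fun_commute_op_factor, of xs p] by (simp add: op_prod_def)
qed

lemma linear_op_op_prod: "linear_op (op_prod n)"
proof -
  have "op_prod n = (\<lambda>p. Finite_Set.fold (\<lambda>(s, t). op_factor s t) p (index_pairs n))"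
    by (simp add: fun_eq_iff op_prod_eq_fold)
  then show ?thesis
    using linear_op_fold[OF comp_fun_commute_op_factor _ finite_index_pairs]
    by (simp add: linear_op_op_factor split: prod.splits)
qed

lemma op_prod_P_diff_op: "op_prod n (P_diff_op j p) = P_diff_op j (op_prod n p)"
  unfolding op_prod_eq_fold
  using fold_intertwine[OF comp_fun_commute_op_factor comp_fun_commute_op_factor
      finite_index_pairs, of id n "P_diff_op j"]
  by (auto simp: op_factor_P_diff_op)

lemma fold_P_diff_op_op_prod:
  assumes "finite A"
  shows "Finite_Set.fold P_diff_op (op_prod n p) A = op_prod n (Finite_Set.fold P_diff_op p A)"
  using fold_intertwine[OF comp_fun_commute_P_diff_op comp_fun_commute_P_diff_op assms,
      of id "op_prod n"]
  by (auto simp: op_prod_P_diff_op)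

section \<open>Renaming variables\<close>

definition relabel :: "(nat \<Rightarrow> nat) \<Rightarrow> func \<Rightarrow> func" where
  "relabel f p = (\<lambda>k. p (k \<circ> f))"

lemma relabel_P_diff_op:
  assumes "inj f"
  shows "relabel f (P_diff_op j p) = P_diff_op (f j) (relabel f p)"
proof -
  have "(k \<circ> f)(j := v) = k(f j := v) \<circ> f" for k :: "nat \<Rightarrow> int" and v
    using assms by (auto simp: fun_eq_iff inj_eq)
  then show ?thesis
    by (simp add: relabel_def P_diff_op_def diff_op_def shift_op_def)
qed

lemma P_diff_op_relabel_notin:
  assumes "i \<notin> range f"
  shows "P_diff_op i (relabel f p) = (\<lambda>k. 0)"
proof -
  have "k(i := v) \<circ> f = k \<circ> f" for k :: "nat \<Rightarrow> int" and v
    using assms by (auto simp: fun_eq_iff)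
  then show ?thesis
    by (simp add: relabel_def P_diff_op_def diff_op_def shift_op_def)
qed

lemma relabel_P_shift_op:
  assumes "inj f"
  shows "relabel f (P_shift_op j p) = P_shift_op (f j) (relabel f p)"
  using fun_cong[OF relabel_P_diff_op[OF assms, of j p]]
  by (simp add: fun_eq_iff P_shift_op_def relabel_def)

lemma relabel_op_factor:
  assumes "inj f"
  shows "relabel f (op_factor s t p) = op_factor (f s) (f t) (relabel f p)"
proof -
  have "relabel f (op_factor s t p)
      = (\<lambda>k. relabel f (P_shift_op t p) k + relabel f (P_diff_op s (P_diff_op t p)) k)"
    by (simp add: relabel_def op_factor_def)
  then show ?thesis
    by (simp add: relabel_P_shift_op relabel_P_diff_op assms op_factor_def)
qed

lemma relabel_fold_op_factor:
  assumes "inj f" "finite A"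
  shows "relabel f (Finite_Set.fold (\<lambda>(s, t). op_factor s t) p A)
    = Finite_Set.fold (\<lambda>(s, t). op_factor s t) (relabel f p) (map_prod f f ` A)"
  by (rule fold_intertwine[OF comp_fun_commute_op_factor comp_fun_commute_op_factor assms(2)])
    (use assms in \<open>auto simp: relabel_op_factor intro: inj_on_subset[OF prod.inj_map]\<close>)

lemma indet_conv_to_fract: "indet = to_fract [:0, 1:]"
  by (simp add: indet_def to_fract_def)

lemma indet_neq_0: "indet \<noteq> 0"
  by (simp add: indet_conv_to_fract)

lemma two_neq_0_rat_poly_fract: "(2 :: rat poly fract) \<noteq> 0"
proof -
  have "(2 :: rat poly fract) = to_fract 2"
    by (simp only: one_add_one[symmetric] to_fract_add to_fract_1)
  then show ?thesis by simp
qed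

text \<open>
  Together with the factor \<open>(i, i + 1)\<close> of \<open>op_prod\<close>, the extra factor \<open>(i + 1, i)\<close> makes the
  operator symmetric in \<open>i\<close> and \<open>i + 1\<close>, so the result inherits the antisymmetry of \<open>p\<close>.
\<close>

lemma op_factor_op_prod_eq_0:
  assumes i: "1 \<le> i" "Suc i \<le> n"
    and anti: "\<And>k. p (k \<circ> Transposition.transpose i (Suc i)) = - p k"
    and eq: "k i = k (Suc i)"
  shows "op_factor (Suc i) i (op_prod n p) k = 0"
proof -
  let ?t = "Transposition.transpose i (Suc i)"
  let ?S = "insert (Suc i, i) (index_pairs n)"
  let ?fold = "\<lambda>p. Finite_Set.fold (\<lambda>(s, t). op_factor s t) p ?S"
  have fin: "finite ?S" by (simp add: finite_index_pairs)
  have Q: "op_factor (Suc i) i (op_prod n p) = ?fold p"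
    using op_factor.fold_insert[OF finite_index_pairs, of "(Suc i, i)" n p]
    by (simp add: op_prod_eq_fold index_pairs_def)
  \<comment> \<open>The swap exchanges \<open>(i, Suc i)\<close> with the added pair
    \<open>(Suc i, i)\<close> and permutes all other pairs among themselves.\<close>
  have img: "map_prod ?t ?t ` ?S = ?S"
  proof -
    have sub: "map_prod ?t ?t ` ?S \<subseteq> ?S"
      using i by (auto simp: index_pairs_def Transposition.transpose_def)
    have "map_prod ?t ?t (map_prod ?t ?t x) = x" for x
      by (cases x) simp
    then have "?S \<subseteq> map_prod ?t ?t ` ?S"
      using sub by (metis (no_types, lifting) image_subset_iff image_eqI subsetI)
    with sub show ?thesis by blast
  qed
  have "relabel ?t p = (\<lambda>k. (- 1) * p k)"
    using anti by (simp add: relabel_def fun_eq_iff)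
  then have "relabel ?t (?fold p) = ?fold (\<lambda>k. (- 1) * p k)"
    using relabel_fold_op_factor[of ?t ?S p] fin img by simp
  also have "\<dots> = (\<lambda>k. (- 1) * ?fold p k)"
    by (rule linear_op_scale)
      (rule linear_op_fold[OF comp_fun_commute_op_factor _ fin], simp add: linear_op_op_factor split: prod.splits)
  finally have "relabel ?t (?fold p) k = - ?fold p k" by simp
  \<comment> \<open>At a point with two equal coordinates the swap does nothing, so the value equals
    its own negative.\<close>
  moreover have "k \<circ> ?t = k"
    using eq by (auto simp: fun_eq_iff Transposition.transpose_def)
  ultimately have "?fold p k = - ?fold p k"
    by (simp add: relabel_def)
  then have "2 * ?fold p k = 0"
    by (metis mult_2 add.right_inverse)
  then show ?thesis
    using two_neq_0_rat_poly_fract by (simp add: Q)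
qed

section \<open>Functions that do not depend on one variable\<close>

definition skip :: "nat \<Rightarrow> nat \<Rightarrow> nat" where
  "skip r j = (if j < r then j else Suc j)"

lemma inj_skip: "inj (skip r)"
  by (auto simp: inj_def skip_def split: if_splits)

lemma skip_ge: "r \<le> j \<Longrightarrow> skip r j = Suc j"
  by (simp add: skip_def)

lemma skip_neq: "skip r j \<noteq> r"
  by (auto simp: skip_def)

lemma P_diff_op_relabel_skip: "P_diff_op r (relabel (skip r) p) = (\<lambda>k. 0)"
  by (rule P_diff_op_relabel_notin) (auto simp: skip_def split: if_splits)

text \<open>In a variable that does not occur, \<open>P_diff_op\<close> gives zero and
  \<open>P_shift_op\<close> is the identity.\<close>

lemma op_factor_relabel_skip_right: "op_factor s r (relabel (skip r) p) = relabel (skip r) p"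
  by (simp add: op_factor_def P_shift_op_def P_diff_op_relabel_skip
      linear_op_zero[OF linear_op_P_diff_op])

lemma op_factor_relabel_skip_left:
  "op_factor r t (relabel (skip r) p) = P_shift_op t (relabel (skip r) p)"
  by (simp add: op_factor_def P_diff_op_commute[of r] P_diff_op_relabel_skip
      linear_op_zero[OF linear_op_P_diff_op])

text \<open>The pairs are sorted by where \<open>r\<close> occurs: those avoiding \<open>r\<close>
  give the renamed \<open>op_prod n\<close>, a pair \<open>(r, t)\<close> leaves only
  \<open>P_shift_op t\<close>, and a pair \<open>(s, r)\<close> acts as the identity. The surviving
  shift operators are exactly those in \<open>edge_sum_unfold\<close>, so all boundary terms come
  under one common operator.\<close>

lemma op_prod_relabel_skip:
  assumes r: "1 \<le> r" "r \<le> Suc n"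
  shows "op_prod (Suc n) (relabel (skip r) p)
    = relabel (skip r) (Finite_Set.fold P_shift_op (op_prod n p) {r..n})"
proof -
  let ?f = "\<lambda>(s, t). op_factor s t"
  let ?A = "map_prod (skip r) (skip r) ` index_pairs n"
  let ?B = "(\<lambda>t. (r, Suc t)) ` {r..n}"
  let ?C = "(\<lambda>s. (s, r)) ` {1..<r}"
  have split: "index_pairs (Suc n) = ?A \<union> ?B \<union> ?C"
  proof (intro subset_antisym subsetI)
    fix x assume "x \<in> index_pairs (Suc n)"
    then obtain s t where x: "x = (s, t)" and st: "1 \<le> s" "s < t" "t \<le> Suc n"
      by (auto simp: index_pairs_def)
    consider "s = r" | "t = r" | "s \<noteq> r" "t \<noteq> r" by blast
    then show "x \<in> ?A \<union> ?B \<union> ?C"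
    proof cases
      case 1
      then have "x = (r, Suc (t - 1))" "t - 1 \<in> {r..n}" using st x by auto
      then show ?thesis by blast
    next
      case 2
      then show ?thesis using st x by auto
    next
      case 3
      \<comment> \<open>The inverse of \<open>skip r\<close> on indices other than
        \<open>r\<close>.\<close>
      let ?s = "if s < r then s else s - 1" and ?t = "if t < r then t else t - 1"
      have "x = map_prod (skip r) (skip r) (?s, ?t)"
        using 3 st x by (auto simp: skip_def)
      moreover have "(?s, ?t) \<in> index_pairs n"
        using 3 st r by (auto simp: index_pairs_def)
      ultimately show ?thesis by blast
    qed
  next
    fix x assume "x \<in> ?A \<union> ?B \<union> ?C"
    then show "x \<in> index_pairs (Suc n)"
      using r by (auto simp: index_pairs_def skip_def)
  qed
  have fin: "finite ?A" "finite ?B" "finite ?C" by (auto simp: finite_index_pairs)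
  have disj: "?A \<inter> ?B = {}" "(?A \<union> ?B) \<inter> ?C = {}"
    using skip_neq[of r] by (auto dest: sym)
  have A: "Finite_Set.fold ?f (relabel (skip r) p) ?A = relabel (skip r) (op_prod n p)"
    by (simp add: relabel_fold_op_factor inj_skip finite_index_pairs op_prod_eq_fold)
  have B: "relabel (skip r) (Finite_Set.fold P_shift_op q {r..n})
      = Finite_Set.fold ?f (relabel (skip r) q) ?B" for q
    by (rule fold_intertwine[OF comp_fun_commute_P_shift_op comp_fun_commute_op_factor])
      (auto simp: inj_on_def relabel_P_shift_op[OF inj_skip] op_factor_relabel_skip_left skip_ge)
  have C: "Finite_Set.fold ?f (relabel (skip r) q) C = relabel (skip r) q"
    if "finite C" "C \<subseteq> UNIV \<times> {r}" for q C
    using that by induction (auto simp: op_factor_relabel_skip_right)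
  have "op_prod (Suc n) (relabel (skip r) p)
      = Finite_Set.fold ?f (Finite_Set.fold ?f (Finite_Set.fold ?f (relabel (skip r) p) ?A) ?B) ?C"
    unfolding op_prod_eq_fold split
    using fin disj by (simp add: op_factor.fold_set_union_disj)
  also have "\<dots> = relabel (skip r) (Finite_Set.fold P_shift_op (op_prod n p) {r..n})"
    unfolding A B[symmetric] by (rule C) auto
  finally show ?thesis .
qed

subsection \<open>Summation over the row above the bottom row\<close>

text \<open>Freezing the coordinates outside \<open>{1..m}\<close> at those of \<open>y\<close>
  makes the box finite, and makes a sum over it a function of \<open>y\<close> to which operators in
  later variables apply.\<close>

definition row_box :: "nat \<Rightarrow> (nat \<Rightarrow> int) \<Rightarrow> (nat \<Rightarrow> int) \<Rightarrow> (nat \<Rightarrow> int) set" where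
  "row_box m k y = {l. (\<forall>j\<in>{1..m}. k j \<le> l j \<and> l j \<le> k (Suc j)) \<and> (\<forall>j. j \<notin> {1..m} \<longrightarrow> l j = y j)}"

lemma row_box_0: "row_box 0 k y = {y}"
  by (auto simp: row_box_def)

lemma row_box_Suc:
  "row_box (Suc m) k y = (\<Union>x\<in>{k (Suc m)..k (Suc (Suc m))}. row_box m k (y(Suc m := x)))"
proof (intro subset_antisym subsetI)
  fix l assume "l \<in> row_box (Suc m) k y"
  then have "l (Suc m) \<in> {k (Suc m)..k (Suc (Suc m))}" "l \<in> row_box m k (y(Suc m := l (Suc m)))"
    by (auto simp: row_box_def)
  then show "l \<in> (\<Union>x\<in>{k (Suc m)..k (Suc (Suc m))}. row_box m k (y(Suc m := x)))"
    by blast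
next
  fix l assume "l \<in> (\<Union>x\<in>{k (Suc m)..k (Suc (Suc m))}. row_box m k (y(Suc m := x)))"
  then obtain x where "x \<in> {k (Suc m)..k (Suc (Suc m))}" "l \<in> row_box m k (y(Suc m := x))"
    by blast
  then show "l \<in> row_box (Suc m) k y"
    by (auto simp: row_box_def le_Suc_eq)
qed

lemma finite_row_box: "finite (row_box m k y)"
  by (induction m arbitrary: y) (simp_all add: row_box_0 row_box_Suc)

lemma row_box_outside: "l \<in> row_box m k y \<Longrightarrow> j \<notin> {1..m} \<Longrightarrow> l j = y j"
  by (auto simp: row_box_def)

lemma sum_row_box_Suc:
  "(\<Sum>l\<in>row_box (Suc m) k y. g l)
    = (\<Sum>x\<in>{k (Suc m)..k (Suc (Suc m))}. \<Sum>l\<in>row_box m k (y(Suc m := x)). g l)"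
  unfolding row_box_Suc
proof (rule sum.UNION_disjoint)
  show "\<forall>i\<in>{k (Suc m)..k (Suc (Suc m))}. \<forall>j\<in>{k (Suc m)..k (Suc (Suc m))}. i \<noteq> j \<longrightarrow>
      row_box m k (y(Suc m := i)) \<inter> row_box m k (y(Suc m := j)) = {}"
    by (auto dest!: row_box_outside[where j = "Suc m"])
qed (auto simp: finite_row_box)

definition step_wt :: "(nat \<Rightarrow> int) \<Rightarrow> nat \<Rightarrow> int \<Rightarrow> rat poly fract" where
  "step_wt k j x = (if x < k (Suc j) then indet powi x else 1)"

text \<open>The indicator is subtracted even if \<open>l j = k (Suc j)\<close>, where
  \<open>P_weight\<close> has no factor. For interlacing rows this makes the factor zero exactly
  when the strict inequality of weak monotone triangles fails there, so sums may range over the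
  whole box.\<close>

definition row_wt :: "nat \<Rightarrow> (nat \<Rightarrow> int) \<Rightarrow> (nat \<Rightarrow> int) \<Rightarrow> rat poly fract" where
  "row_wt m k l = (\<Prod>j=1..m. step_wt k j (l j) - of_bool (2 \<le> j \<and> l j = l (j - 1)))"

text \<open>
  Expanding \<open>row_wt\<close> with the coincidences \<open>l j = l (j - 1)\<close> restricted to disjoint pairs; the
  two weights agree unless three consecutive entries coincide.
\<close>

fun pair_wt :: "nat \<Rightarrow> (nat \<Rightarrow> int) \<Rightarrow> (nat \<Rightarrow> int) \<Rightarrow> rat poly fract" where
  "pair_wt 0 k l = 1"
| "pair_wt (Suc 0) k l = step_wt k 1 (l 1)"
| "pair_wt (Suc (Suc m)) k l = step_wt k (Suc (Suc m)) (l (Suc (Suc m))) * pair_wt (Suc m) k l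
     - of_bool (l (Suc m) = l (Suc (Suc m))) * pair_wt m k l"

lemma row_wt_Suc: "row_wt (Suc m) k l
    = row_wt m k l * (step_wt k (Suc m) (l (Suc m)) - of_bool (1 \<le> m \<and> l (Suc m) = l m))"
  by (simp add: row_wt_def Suc_le_eq)

text \<open>If \<open>l (Suc i)\<close> and \<open>l (Suc (Suc i))\<close> coincide, interlacing
  forces both to be \<open>k (Suc (Suc i))\<close>, so \<open>step_wt\<close> at
  \<open>Suc i\<close> is 1. Without a triple coincidence the whole factor of \<open>row_wt\<close>
  at \<open>Suc i\<close> is then 1, and \<open>row_wt\<close> obeys the recursion of
  \<open>pair_wt\<close>.\<close>

lemma row_wt_eq_pair_wt:
  assumes "l \<in> row_box m k y"
    and "\<And>j. 1 \<le> j \<Longrightarrow> j + 2 \<le> m \<Longrightarrow> \<not> (l j = l (j + 1) \<and> l (j + 1) = l (j + 2))"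
  shows "row_wt m k l = pair_wt m k l"
proof -
  have "row_wt i k l = pair_wt i k l" if "i \<le> m" for i
    using that
  proof (induction i rule: induct_nat_012)
    case 0
    then show ?case by (simp add: row_wt_def)
  next
    case 1
    then show ?case by (simp add: row_wt_def)
  next
    case (ge2 i)
    show ?case
    proof (cases "l (Suc i) = l (Suc (Suc i))")
      case True
      have "k (Suc (Suc i)) \<le> l (Suc (Suc i))" "l (Suc i) \<le> k (Suc (Suc i))"
        using assms(1) ge2.prems by (auto simp: row_box_def)
      then have "l (Suc i) = k (Suc (Suc i))" using True by simp
      then have "step_wt k (Suc i) (l (Suc i)) = 1" by (simp add: step_wt_def)
      moreover have "\<not> (1 \<le> i \<and> l (Suc i) = l i)"
        using assms(2)[of i] True ge2.prems by auto
      ultimately have "row_wt (Suc i) k l = row_wt i k l * (1 - of_bool False)"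
        unfolding row_wt_Suc by (simp only:)
      then have "row_wt (Suc i) k l = pair_wt i k l"
        using ge2 by simp
      then show ?thesis
        using ge2 True by (simp add: row_wt_Suc[of "Suc i"] algebra_simps)
    next
      case False
      then show ?thesis
        using ge2 by (simp add: row_wt_Suc[of "Suc i"])
    qed
  qed
  then show ?thesis by simp
qed

text \<open>Interlacing leaves no choice for the entries \<open>j\<close> and \<open>Suc j\<close>,
  and the factor at \<open>Suc j\<close> becomes 1 - 1.\<close>

lemma row_wt_eq_0:
  assumes "l \<in> row_box m k y" "1 \<le> j" "j < m" "k j = k (j + 1)" "k (j + 1) = k (j + 2)"
  shows "row_wt m k l = 0"
proof -
  have "k i \<le> l i \<and> l i \<le> k (Suc i)" if "i = j \<or> i = Suc j" for i
    using assms(1-3) that by (auto simp: row_box_def)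
  from this[of j] this[of "Suc j"] have "l j = k (Suc j)" "l (Suc j) = k (Suc (Suc j))"
    using assms(4,5) by auto
  then have "step_wt k (Suc j) (l (Suc j)) - of_bool (2 \<le> Suc j \<and> l (Suc j) = l (Suc j - 1)) = 0"
    using assms by (simp add: step_wt_def)
  then show ?thesis
    unfolding row_wt_def using assms by (intro prod_zero) (auto intro!: bexI[of _ "Suc j"])
qed

lemma pair_wt_cong: "(\<And>j. j \<in> {1..m} \<Longrightarrow> l j = l' j) \<Longrightarrow> pair_wt m k l = pair_wt m k l'"
  by (induction m k l rule: pair_wt.induct) auto

section \<open>Weighted sums over a box and their boundary terms\<close>

definition box_sum :: "nat \<Rightarrow> (nat \<Rightarrow> int) \<Rightarrow> func \<Rightarrow> func" where
  "box_sum m k p y = (\<Sum>l\<in>row_box m k y. pair_wt m k l * p l)"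

lemma box_sum_0: "box_sum 0 k p y = p y"
  by (simp add: box_sum_def row_box_0)

lemma box_sum_1:
  "box_sum (Suc 0) k p y = (\<Sum>x\<in>{k 1..k 2}. step_wt k 1 x * p (y(1 := x)))"
  by (simp add: box_sum_def sum_row_box_Suc row_box_0 numeral_2_eq_2)

text \<open>The intervals of the last two coordinates meet only in \<open>k (Suc (Suc m))\<close>,
  so the coincidence term of \<open>pair_wt\<close> freezes both coordinates at that value.\<close>

lemma box_sum_Suc_Suc:
  fixes k :: "nat \<Rightarrow> int"
  assumes "k (Suc m) \<le> k (Suc (Suc m))" "k (Suc (Suc m)) \<le> k (Suc (Suc (Suc m)))"
  shows "box_sum (Suc (Suc m)) k p y =
     (\<Sum>x\<in>{k (Suc (Suc m))..k (Suc (Suc (Suc m)))}.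
        step_wt k (Suc (Suc m)) x * box_sum (Suc m) k p (y(Suc (Suc m) := x)))
     - box_sum m k p (y(Suc m := k (Suc (Suc m)), Suc (Suc m) := k (Suc (Suc m))))"
proof -
  let ?m1 = "Suc m" and ?m2 = "Suc (Suc m)"
  let ?X = "{k ?m2..k (Suc ?m2)}" and ?X' = "{k ?m1..k ?m2}"
  have "box_sum ?m2 k p y = (\<Sum>x\<in>?X. \<Sum>l\<in>row_box ?m1 k (y(?m2 := x)).
      step_wt k ?m2 x * (pair_wt ?m1 k l * p l) - of_bool (l ?m1 = x) * (pair_wt m k l * p l))"
    unfolding box_sum_def sum_row_box_Suc[where m = ?m1]
    by (intro sum.cong refl) (auto simp: row_box_outside algebra_simps)
  also have "\<dots> = (\<Sum>x\<in>?X. step_wt k ?m2 x * box_sum ?m1 k p (y(?m2 := x)))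
      - (\<Sum>x\<in>?X. \<Sum>l\<in>row_box ?m1 k (y(?m2 := x)). of_bool (l ?m1 = x) * (pair_wt m k l * p l))"
    by (simp add: sum_subtractf box_sum_def sum_distrib_left)
  also have "(\<Sum>x\<in>?X. \<Sum>l\<in>row_box ?m1 k (y(?m2 := x)). of_bool (l ?m1 = x) * (pair_wt m k l * p l))
      = (\<Sum>x\<in>?X. \<Sum>x'\<in>?X'. of_bool (x' = x) * box_sum m k p (y(?m2 := x, ?m1 := x')))"
    unfolding sum_row_box_Suc[where m = m] box_sum_def sum_distrib_left
    by (intro sum.cong refl) (auto simp: row_box_outside)
  also have "\<dots> = (\<Sum>x\<in>?X. if x = k ?m2 then box_sum m k p (y(?m2 := x, ?m1 := x)) else 0)"
    using assms by (intro sum.cong refl) (auto simp: of_bool_def if_distrib if_distribR cong: if_cong)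
  also have "\<dots> = box_sum m k p (y(?m1 := k ?m2, ?m2 := k ?m2))"
    using assms by (simp add: fun_upd_twist)
  finally show ?thesis .
qed

lemma box_sum_fun_upd:
  assumes "j \<notin> {1..m}"
  shows "box_sum m k p (y(j := v)) = (\<Sum>l\<in>row_box m k y. pair_wt m k l * p (l(j := v)))"
  unfolding box_sum_def
proof (rule sum.reindex_bij_witness[where i = "\<lambda>l. l(j := v)" and j = "\<lambda>l. l(j := y j)"])
  fix l assume l: "l \<in> row_box m k (y(j := v))"
  then have "l j = v" using assms by (auto simp: row_box_def)
  then have upd: "(l(j := y j))(j := v) = l" by auto
  show "(l(j := y j))(j := v) = l" by fact
  show "l(j := y j) \<in> row_box m k y" using l assms by (auto simp: row_box_def)
  have "pair_wt m k (l(j := y j)) = pair_wt m k l"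
    using assms by (intro pair_wt_cong) auto
  then show "pair_wt m k (l(j := y j)) * p ((l(j := y j))(j := v)) = pair_wt m k l * p l"
    by (simp only: upd)
next
  fix l assume l: "l \<in> row_box m k y"
  then have "l j = y j" using assms by (auto simp: row_box_def)
  then show "(l(j := v))(j := y j) = l" by auto
  show "l(j := v) \<in> row_box m k (y(j := v))" using l assms by (auto simp: row_box_def)
qed

lemma box_sum_P_diff_op:
  assumes "j \<notin> {1..m}"
  shows "box_sum m k (P_diff_op j p) = P_diff_op j (box_sum m k p)"
proof
  fix y
  have "box_sum m k (P_diff_op j p) y = (\<Sum>l\<in>row_box m k y.
      indet powi (- y j) * (pair_wt m k l * p (l(j := y j + 1)) - pair_wt m k l * p l))"
    unfolding box_sum_def P_diff_op_def diff_op_def shift_op_def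
    using assms by (intro sum.cong refl) (simp add: row_box_outside algebra_simps)
  also have "\<dots> = P_diff_op j (box_sum m k p) y"
    unfolding P_diff_op_def diff_op_def shift_op_def box_sum_fun_upd[OF assms]
    by (simp add: box_sum_def sum_subtractf flip: sum_distrib_left)
  finally show "box_sum m k (P_diff_op j p) y = P_diff_op j (box_sum m k p) y" .
qed

text \<open>The weight \<open>indet powi x\<close> cancels the power in \<open>P_diff_op\<close>, so
  the terms with \<open>x < k (Suc j)\<close> telescope. The last term has weight 1 and turns the
  upper boundary value of \<open>p\<close> into that of \<open>P_shift_op i p\<close>.\<close>

lemma sum_step_wt_P_diff_op:
  assumes "k j \<le> k (Suc j)"
  shows "(\<Sum>x\<in>{k j..k (Suc j)}. step_wt k j x * P_diff_op i p (y(i := x)))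
    = P_shift_op i p (y(i := k (Suc j))) - p (y(i := k j))"
proof -
  have diff: "indet powi x * P_diff_op i p (y(i := x)) = p (y(i := x + 1)) - p (y(i := x))" for x
  proof -
    have "indet powi x * indet powi (- x) = 1"
      using indet_neq_0 by (simp flip: power_int_add)
    then show ?thesis
      by (simp add: P_diff_op_def diff_op_def shift_op_def flip: mult.assoc)
  qed
  have tele: "(\<Sum>x\<in>{a..<b}. indet powi x * P_diff_op i p (y(i := x))) = p (y(i := b)) - p (y(i := a))"
    if "a \<le> b" for a b
    using that
  proof (induction b rule: int_ge_induct)
    case base
    then show ?case by simp
  next
    case (step b)
    have "{a..<b + 1} = insert b {a..<b}" using step.hyps by auto
    then have eq: "(\<Sum>x\<in>{a..<b + 1}. indet powi x * P_diff_op i p (y(i := x)))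
        = indet powi b * P_diff_op i p (y(i := b)) + (p (y(i := b)) - p (y(i := a)))"
      by (simp add: step.IH del: fun_upd_apply)
    show ?case unfolding eq by (simp add: diff del: fun_upd_apply)
  qed
  have "{k j..k (Suc j)} = insert (k (Suc j)) {k j..<k (Suc j)}" using assms by auto
  then have "(\<Sum>x\<in>{k j..k (Suc j)}. step_wt k j x * P_diff_op i p (y(i := x)))
      = P_diff_op i p (y(i := k (Suc j)))
        + (\<Sum>x\<in>{k j..<k (Suc j)}. indet powi x * P_diff_op i p (y(i := x)))"
    by (simp add: step_wt_def)
  then show ?thesis
    by (simp add: tele[OF assms] P_shift_op_def)
qed

text \<open>A variable at its upper endpoint carries \<open>P_shift_op\<close>, one at its lower
  endpoint a sign. Terms where a variable at its lower endpoint follows one at its upper endpoint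
  are left out, since the two would share a value; hence a lower endpoint for \<open>Suc m\<close>
  forces lower endpoints throughout, which is the second summand.\<close>

fun edge_sum :: "nat \<Rightarrow> (nat \<Rightarrow> int) \<Rightarrow> func \<Rightarrow> func" where
  "edge_sum 0 k p y = p y"
| "edge_sum (Suc m) k p y = edge_sum m k (P_shift_op (Suc m) p) (y(Suc m := k (Suc (Suc m))))
     + (- 1) ^ Suc m * p (\<lambda>j. if j \<in> {1..Suc m} then k j else y j)"

lemma edge_sum_add: "edge_sum m k (\<lambda>y. p y + q y) = (\<lambda>y. edge_sum m k p y + edge_sum m k q y)"
proof (induction m arbitrary: p q)
  case (Suc m)
  show ?case
    by (simp add: fun_eq_iff linear_op_add[OF linear_op_P_shift_op] Suc.IH algebra_simps)
qed auto

lemma edge_sum_P_diff_op: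
  "m < j \<Longrightarrow> edge_sum m k (P_diff_op j p) = P_diff_op j (edge_sum m k p)"
proof (induction m arbitrary: p)
  case (Suc m)
  let ?u = "\<lambda>y i. if i \<in> {1..Suc m} then k i else (y i :: int)"
  have u: "?u (y(j := v)) = (?u y)(j := v)" "?u y j = y j" for y v
    using Suc.prems by auto
  have "(y(Suc m := w))(j := v) = (y(j := v))(Suc m := w)" for y :: "nat \<Rightarrow> int" and v w
    using Suc.prems by (auto simp: fun_upd_twist)
  then have "P_diff_op j q (y(Suc m := w)) = P_diff_op j (\<lambda>y. q (y(Suc m := w))) y" for q y w
    using Suc.prems by (simp add: P_diff_op_def diff_op_def shift_op_def)
  moreover have "P_diff_op j p (?u y) = P_diff_op j (\<lambda>y. p (?u y)) y" for y
    unfolding P_diff_op_def diff_op_def shift_op_def u ..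
  ultimately show ?case
    using Suc by (simp add: fun_eq_iff P_shift_op_P_diff_op P_diff_op_add P_diff_op_scale
        del: power_Suc)
next
  case 0
  have "edge_sum 0 k q = q" for q by (simp add: fun_eq_iff)
  then show ?case by simp
qed

lemma P_shift_op_eq_0:
  assumes "\<And>y. y i = y i' \<Longrightarrow> p y = 0" "y i = y i'" "j \<noteq> i" "j \<noteq> i'"
  shows "P_shift_op j p y = 0"
  using assms by (simp add: P_shift_op_def P_diff_op_def diff_op_def shift_op_def)

text \<open>All operators and substitutions concern variables up to \<open>m\<close>, so the
  vanishing on the diagonal of \<open>i\<close> and \<open>i'\<close> persists.\<close>

lemma edge_sum_eq_0:
  assumes "\<And>y. y i = y i' \<Longrightarrow> p y = 0" "y i = y i'" "m < i" "m < i'"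
  shows "edge_sum m k p y = 0"
  using assms
proof (induction m arbitrary: p y)
  case (Suc m)
  have "edge_sum m k (P_shift_op (Suc m) p) (y(Suc m := k (Suc (Suc m)))) = 0"
    using Suc.prems(2-4) P_shift_op_eq_0[of i i' p, OF Suc.prems(1)] by (intro Suc.IH) auto
  moreover have "p (\<lambda>j. if j \<in> {1..Suc m} then k j else y j) = 0"
    using Suc.prems(2-4) by (intro Suc.prems(1)) auto
  ultimately show ?case by simp
qed auto

text \<open>
  The terms in which two of the summation variables \<open>i\<close>, \<open>i + 1\<close> take the same boundary value
  combine to \<open>op_factor (Suc i) i B\<close>, so they cancel.
\<close>

lemma box_sum_eq_edge_sum:
  assumes "\<And>j. j \<in> {1..m} \<Longrightarrow> k j \<le> k (Suc j)"
    and "\<And>i y. 1 \<le> i \<Longrightarrow> Suc i \<le> m \<Longrightarrow> y i = y (Suc i) \<Longrightarrow> op_factor (Suc i) i B y = 0"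
  shows "box_sum m k (Finite_Set.fold P_diff_op B {1..m}) = edge_sum m k B"
  using assms
proof (induction m rule: induct_nat_012)
  case 0
  show ?case by (simp add: fun_eq_iff box_sum_0)
next
  case 1
  show ?case
  proof
    fix y
    have "(\<lambda>j. if j \<in> {1..Suc 0} then k j else y j) = y(Suc 0 := k (Suc 0))" by auto
    then have "edge_sum (Suc 0) k B y
        = P_shift_op (Suc 0) B (y(Suc 0 := k (Suc (Suc 0)))) - B (y(Suc 0 := k (Suc 0)))"
      by (simp only: edge_sum.simps) simp
    then show "box_sum (Suc 0) k (Finite_Set.fold P_diff_op B {1..Suc 0}) y = edge_sum (Suc 0) k B y"
      using 1(1) by (simp add: box_sum_1 numeral_2_eq_2 sum_step_wt_P_diff_op)
  qed
next
  case (ge2 m)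
  let ?m1 = "Suc m" and ?m2 = "Suc (Suc m)" and ?D = "\<lambda>m. Finite_Set.fold P_diff_op B {1..m}"
  have D1: "?D ?m1 = P_diff_op ?m1 (?D m)" and D2: "?D ?m2 = P_diff_op ?m2 (?D ?m1)"
    by (simp_all add: atLeastAtMostSuc_conv)
  have m: "box_sum m k (?D m) = edge_sum m k B"
    using ge2.prems by (intro ge2.IH(1)) auto
  have m1: "box_sum ?m1 k (?D ?m1) = edge_sum ?m1 k B"
    using ge2.prems by (intro ge2.IH(2)) auto
  have s1: "box_sum ?m1 k (?D ?m2) = P_diff_op ?m2 (edge_sum ?m1 k B)"
    unfolding D2 using m1 by (simp add: box_sum_P_diff_op)
  have s2: "box_sum m k (?D ?m2) = edge_sum m k (P_diff_op ?m2 (P_diff_op ?m1 B))"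
    unfolding D2 D1 using m by (simp add: box_sum_P_diff_op edge_sum_P_diff_op)
  have k1: "k ?m1 \<le> k ?m2" and k2: "k ?m2 \<le> k (Suc ?m2)"
    using ge2.prems(1)[of ?m1] ge2.prems(1)[of ?m2] by auto
  show ?case
  proof
    fix y
    let ?y = "y(?m1 := k ?m2, ?m2 := k ?m2)"
    \<comment> \<open>At \<open>?y\<close> variable \<open>?m1\<close> is at its upper and
      \<open>?m2\<close> at its lower endpoint. The two parts of \<open>op_factor\<close> are the
      resulting boundary term and the coincidence term of \<open>pair_wt\<close>.\<close>
    have "edge_sum m k (op_factor ?m2 ?m1 B) ?y = 0"
      using ge2.prems(2)[of ?m1] by (intro edge_sum_eq_0[of ?m1 ?m2]) auto
    then have cancel: "edge_sum m k (P_shift_op ?m1 B) ?y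
        + edge_sum m k (P_diff_op ?m2 (P_diff_op ?m1 B)) ?y = 0"
      by (simp add: op_factor_def edge_sum_add)
    \<comment> \<open>The lower endpoint of \<open>?m2\<close>: the first summand is removed by
      \<open>cancel\<close>, the second has every variable at its lower endpoint.\<close>
    have "edge_sum ?m1 k B (y(?m2 := k ?m2)) = edge_sum m k (P_shift_op ?m1 B) ?y
        + (- 1) ^ ?m1 * B (\<lambda>j. if j \<in> {1..?m2} then k j else y j)"
    proof -
      have "(\<lambda>j. if j \<in> {1..?m1} then k j else (y(?m2 := k ?m2)) j)
          = (\<lambda>j. if j \<in> {1..?m2} then k j else y j)"
        by (auto simp: fun_eq_iff le_Suc_eq)
      then show ?thesis by (simp add: fun_upd_twist)
    qed
    moreover have "box_sum ?m2 k (?D ?m2) y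
        = P_shift_op ?m2 (edge_sum ?m1 k B) (y(?m2 := k (Suc ?m2)))
          - edge_sum ?m1 k B (y(?m2 := k ?m2))
          - edge_sum m k (P_diff_op ?m2 (P_diff_op ?m1 B)) ?y"
      unfolding box_sum_Suc_Suc[OF k1 k2] s1 s2 sum_step_wt_P_diff_op[of k ?m2, OF k2] ..
    moreover have "P_shift_op ?m2 (edge_sum ?m1 k B) = edge_sum ?m1 k (P_shift_op ?m2 B)"
      unfolding P_shift_op_def by (simp only: edge_sum_add) (simp only: edge_sum_P_diff_op lessI)
    ultimately have "box_sum ?m2 k (?D ?m2) y = edge_sum ?m1 k (P_shift_op ?m2 B) (y(?m2 := k (Suc ?m2)))
        + (- 1) ^ ?m2 * B (\<lambda>j. if j \<in> {1..?m2} then k j else y j)"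
      using cancel by (simp add: algebra_simps add_eq_0_iff2)
    then show "box_sum ?m2 k (?D ?m2) y = edge_sum ?m2 k B y"
      by (simp only: edge_sum.simps(2)[of ?m1])
  qed
qed

text \<open>The index \<open>r\<close> marks the switch from lower to upper endpoints: variables
  below \<open>r\<close> take \<open>k j\<close>, the others \<open>k (Suc j)\<close>, and exactly
  \<open>k r\<close> is omitted.\<close>

lemma edge_sum_unfold:
  "edge_sum m k p y = (\<Sum>r=1..Suc m. (- 1) ^ (r - 1) *
     Finite_Set.fold P_shift_op p {r..m} (\<lambda>j. if j \<in> {1..m} then k (skip r j) else y j))"
proof (induction m arbitrary: p y)
  case 0
  show ?case by simp
next
  case (Suc m)
  let ?u = "\<lambda>m r y j. if j \<in> {1..m} then k (skip r j) else (y j :: int)"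
  have u: "?u m r (y(Suc m := k (Suc (Suc m)))) = ?u (Suc m) r y" if "r \<le> Suc m" for r
    using that by (auto simp: skip_def fun_eq_iff le_Suc_eq)
  \<comment> \<open>The operator in variable \<open>Suc m\<close> goes innermost, because
    \<open>edge_sum\<close> applies it to \<open>p\<close> first.\<close>
  have F: "Finite_Set.fold P_shift_op p {r..Suc m} = Finite_Set.fold P_shift_op (P_shift_op (Suc m) p) {r..m}"
    if "r \<le> Suc m" for r
    using that by (simp add: atLeastAtMostSuc_conv P_shift_op.fold_insert2 del: P_shift_op.fold_insert)
  have last: "(\<lambda>j. if j \<in> {1..Suc m} then k j else y j) = ?u (Suc m) (Suc (Suc m)) y"
    by (auto simp: skip_def)
  have "edge_sum (Suc m) k p y = (\<Sum>r=1..Suc m. (- 1) ^ (r - 1) *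
      Finite_Set.fold P_shift_op (P_shift_op (Suc m) p) {r..m} (?u m r (y(Suc m := k (Suc (Suc m))))))
      + (- 1) ^ Suc m * p (?u (Suc m) (Suc (Suc m)) y)"
    unfolding edge_sum.simps Suc.IH last ..
  also have "(\<Sum>r=1..Suc m. (- 1) ^ (r - 1) *
      Finite_Set.fold P_shift_op (P_shift_op (Suc m) p) {r..m} (?u m r (y(Suc m := k (Suc (Suc m))))))
    = (\<Sum>r=1..Suc m. (- 1) ^ (r - 1) * Finite_Set.fold P_shift_op p {r..Suc m} (?u (Suc m) r y))"
    by (intro sum.cong refl) (use u F in simp)
  finally show ?case
    by (simp only: sum.cl_ivl_Suc) simp
qed

subsection \<open>Determinants\<close>

definition power_mat :: "nat \<Rightarrow> nat \<Rightarrow> (nat \<Rightarrow> 'a :: comm_ring_1) \<Rightarrow> 'a mat" where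
  "power_mat e n x = mat n n (\<lambda>(i, j). x i ^ (j + e))"

lemma power_mat_carrier: "power_mat e n x \<in> carrier_mat n n"
  by (simp add: power_mat_def)

lemma det_power_mat_cong:
  "(\<And>i. i < n \<Longrightarrow> x i = x' i) \<Longrightarrow> det (power_mat e n x) = det (power_mat e n x')"
  unfolding power_mat_def by (intro arg_cong[where f = det] cong_mat) auto

lemma det_power_mat_eq_0:
  assumes "i < j" "j < n" "x i = x j"
  shows "det (power_mat e n x) = 0"
  by (rule det_identical_rows[OF power_mat_carrier, of i j])
    (use assms in \<open>auto simp: power_mat_def intro!: eq_vecI\<close>)

text \<open>Column 0 consists of ones, and deleting it raises the lowest exponent to 1.\<close>

lemma det_power_mat_expand_column:
  "det (power_mat 0 (Suc n) x)
    = (\<Sum>r\<le>n. (- 1) ^ r * det (power_mat 1 n (\<lambda>i. x (if i < r then i else Suc i))))"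
proof -
  let ?A = "power_mat 0 (Suc n) x"
  have "mat_delete ?A r 0 = power_mat 1 n (\<lambda>i. x (if i < r then i else Suc i))" for r
    by (rule eq_matI) (auto simp: mat_delete_def power_mat_def)
  moreover have "?A $$ (r, 0) = 1" if "r < Suc n" for r
    using that by (simp add: power_mat_def)
  ultimately show ?thesis
    using laplace_expansion_column[OF power_mat_carrier, of 0 "Suc n" 0 x]
    by (simp add: cofactor_def lessThan_Suc_atMost)
qed

lemma det_power_mat_expand_last_row:
  "det (power_mat 0 (Suc n) x)
    = (\<Sum>j\<le>n. x n ^ j * cofactor (power_mat 0 (Suc n) x) n j)"
proof -
  have "power_mat 0 (Suc n) x $$ (n, j) = x n ^ j" if "j < Suc n" for j
    using that by (simp add: power_mat_def)
  then show ?thesis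
    using laplace_expansion_row[OF power_mat_carrier, of n "Suc n" 0 x]
    by (simp add: lessThan_Suc_atMost)
qed

text \<open>
  As a polynomial in the last variable, the determinant has degree at most \<open>n\<close>, the roots
  \<open>x 0, \<dots>, x (n - 1)\<close>, and the smaller determinant as its leading coefficient.
\<close>

lemma det_power_mat_Suc:
  fixes x :: "nat \<Rightarrow> 'a :: field"
  assumes "inj_on x {..<n}"
  shows "det (power_mat 0 (Suc n) x) = (\<Prod>i<n. x n - x i) * det (power_mat 0 n x)"
proof -
  let ?c = "\<lambda>j. cofactor (power_mat 0 (Suc n) x) n j"
  define p where "p = (\<Sum>j\<le>n. monom (?c j) j)"
  define q where "q = Polynomial.smult (det (power_mat 0 n x)) (\<Prod>i<n. [:- x i, 1:])"
  \<comment> \<open>Cofactors along the last row do not involve the last node, so they are the same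
    for every \<open>z\<close>.\<close>
  have cof: "cofactor (power_mat 0 (Suc n) (x(n := z))) n j = ?c j" if "j \<le> n" for z j
    unfolding cofactor_def using that
    by (intro arg_cong2[where f = times] refl arg_cong[where f = det] eq_matI)
      (auto simp: mat_delete_def power_mat_def)
  have p: "poly p z = det (power_mat 0 (Suc n) (x(n := z)))" for z
    unfolding det_power_mat_expand_last_row
    by (simp add: p_def poly_sum poly_monom cof mult.commute)
  have deg: "degree (\<Prod>i<n. [:- x i, 1:]) = n"
    by (simp add: degree_prod_eq_sum_degree)
  have "lead_coeff (\<Prod>i<n. [:- x i, 1:]) = 1"
    by (simp only: lead_coeff_prod) simp
  with deg have lc: "coeff (\<Prod>i<n. [:- x i, 1:]) n = 1" by metis
  have "p = q"
  proof (rule poly_eqI_degree_lead_coeff[where n = n and A = "x ` {..<n}"])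
    have "mat_delete (power_mat 0 (Suc n) x) n n = power_mat 0 n x"
      by (rule eq_matI) (auto simp: mat_delete_def power_mat_def)
    then have "?c n = det (power_mat 0 n x)"
      by (simp add: cofactor_def flip: power2_eq_square mult_2)
    moreover have "coeff p n = ?c n"
      by (simp add: p_def coeff_sum)
    ultimately show "coeff p n = coeff q n"
      using deg lc by (simp add: q_def)
    show "n \<le> card (x ` {..<n})"
      using assms by (simp add: card_image)
    show "degree p \<le> n"
      unfolding p_def by (intro degree_sum_le) (auto intro: order.trans[OF degree_monom_le])
    show "degree q \<le> n"
      unfolding q_def using deg by (metis degree_smult_le)
    fix z assume "z \<in> x ` {..<n}"
    then obtain i where i: "i < n" "z = x i" by auto
    then have "poly p z = 0"
      unfolding p by (intro det_power_mat_eq_0[of i n]) auto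
    moreover have "poly q z = 0"
      using i by (auto simp: q_def poly_prod)
    ultimately show "poly p z = poly q z" by simp
  qed
  then have "poly p (x n) = poly q (x n)" by simp
  then show ?thesis
    by (simp add: p q_def poly_prod mult.commute)
qed

text \<open>Counting roots in \<open>det_power_mat_Suc\<close> requires distinct nodes; if two of
  them coincide, both sides vanish.\<close>

lemma det_power_mat_0:
  fixes x :: "nat \<Rightarrow> 'a :: field"
  shows "det (power_mat 0 n x) = (\<Prod>j<n. \<Prod>i<j. x j - x i)"
proof (induction n)
  case 0
  show ?case by (simp add: power_mat_def det_def)
next
  case (Suc n)
  show ?case
  proof (cases "inj_on x {..<n}")
    case True
    then show ?thesis by (simp add: det_power_mat_Suc Suc.IH mult.commute)
  next
    case False
    then obtain i j where ij: "i < j" "j < n" "x i = x j"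
      by (auto simp: inj_on_def) (metis linorder_neqE_nat)
    then have 0: "(\<Prod>i<j. x j - x i) = 0" by (intro prod_zero bexI[of _ i]) auto
    have "(\<Prod>j<Suc n. \<Prod>i<j. x j - x i) = 0"
      by (rule prod_zero[rotated], rule bexI[of _ j], rule 0) (use ij in auto)
    then show ?thesis
      using ij det_power_mat_eq_0[of i j "Suc n" x 0] by simp
  qed
qed

lemma det_power_mat_swap:
  assumes "Suc i < n"
  shows "det (power_mat e n (x \<circ> Transposition.transpose i (Suc i))) = - det (power_mat e n x)"
proof -
  have "power_mat e n (x \<circ> Transposition.transpose i (Suc i)) = swaprows i (Suc i) (power_mat e n x)"
    using assms by (intro eq_matI) (auto simp: power_mat_def Transposition.transpose_def)
  then show ?thesis
    using det_swaprows[of i n "Suc i" "power_mat e n x"] assms by (simp add: power_mat_carrier)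
qed

text \<open>Matrix rows are numbered from 0, the variables from 1.\<close>

definition power_det :: "nat \<Rightarrow> nat \<Rightarrow> func" where
  "power_det e n k = det (power_mat e n (\<lambda>i. indet powi k (Suc i)))"

lemma power_det_swap:
  assumes "1 \<le> i" "Suc i \<le> n"
  shows "power_det e n (k \<circ> Transposition.transpose i (Suc i)) = - power_det e n k"
proof -
  obtain i' where i: "i = Suc i'" using assms by (cases i) auto
  have "(\<lambda>j. indet powi (k \<circ> Transposition.transpose i (Suc i)) (Suc j))
      = (\<lambda>j. indet powi k (Suc j)) \<circ> Transposition.transpose i' (Suc i')"
    by (auto simp: i Transposition.transpose_def)
  then show ?thesis
    using det_power_mat_swap[of i' n e] assms by (simp add: power_det_def i)
qed

lemma power_det_expand_column:
  "power_det 0 (Suc n) k = (\<Sum>r=1..Suc n. (- 1) ^ (r - 1) * power_det 1 n (k \<circ> skip r))"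
proof -
  have "power_det 0 (Suc n) k = (\<Sum>r\<le>n. (- 1) ^ r * power_det 1 n (k \<circ> skip (Suc r)))"
    unfolding power_det_def det_power_mat_expand_column
    by (intro sum.cong refl arg_cong2[where f = times] det_power_mat_cong)
      (auto simp: skip_def)
  also have "\<dots> = (\<Sum>r=1..Suc n. (- 1) ^ (r - 1) * power_det 1 n (k \<circ> skip r))"
    by (rule sum.reindex_bij_witness[where i = "\<lambda>r. r - 1" and j = Suc]) auto
  finally show ?thesis .
qed

text \<open>On a single power, P^(-x) * (P^((m+1)(x+1)) - P^((m+1)x)) = (P^(m+1) - 1) * P^(mx): each
  operator lowers the exponent of its own variable by one, at the cost of a constant.\<close>

lemma fold_P_diff_op_prod:
  assumes "finite I" "A \<subseteq> I"
  shows "Finite_Set.fold P_diff_op (\<lambda>k. \<Prod>i\<in>I. (indet powi k i) ^ Suc (f i)) A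
    = (\<lambda>k. (\<Prod>i\<in>A. indet ^ Suc (f i) - 1) *
        (\<Prod>i\<in>I. if i \<in> A then (indet powi k i) ^ f i else (indet powi k i) ^ Suc (f i)))"
proof -
  have "finite A" using assms finite_subset by blast
  then show ?thesis
    using assms(2)
  proof induction
    case (insert a A)
    let ?g = "\<lambda>A k i. if i \<in> A then (indet powi k i) ^ f i else (indet powi k i) ^ Suc (f i)"
    \<comment> \<open>Isolates the only factor that depends on \<open>k a\<close>.\<close>
    have I: "I = insert a (I - {a})" using insert by auto
    have "P_diff_op a (\<lambda>k. \<Prod>i\<in>I. ?g A k i)
        = (\<lambda>k. (indet ^ Suc (f a) - 1) * (\<Prod>i\<in>I. ?g (insert a A) k i))"
    proof
      fix k :: "nat \<Rightarrow> int"
      let ?R = "\<Prod>i\<in>I - {a}. ?g A k i"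
      have "(\<Prod>i\<in>I. ?g A (k(a := v)) i) = (indet powi v) ^ Suc (f a) * ?R" for v
      proof -
        have "(\<Prod>i\<in>I - {a}. ?g A (k(a := v)) i) = ?R" by (intro prod.cong) auto
        then show ?thesis
          using insert assms by (subst I) (simp add: prod.insert_remove)
      qed
      from this[of "k a + 1"] this[of "k a"]
      have "P_diff_op a (\<lambda>k. \<Prod>i\<in>I. ?g A k i) k
          = indet powi (- k a) * ((indet powi (k a + 1)) ^ Suc (f a) * ?R - (indet powi k a) ^ Suc (f a) * ?R)"
        by (simp only: P_diff_op_def diff_op_def shift_op_def fun_upd_triv)
      also have "\<dots> = (indet ^ Suc (f a) - 1) * ((indet powi k a) ^ f a * ?R)"
      proof -
        have *: "inverse x * ((x * p) ^ Suc m * R - x ^ Suc m * R) = (p ^ Suc m - 1) * (x ^ m * R)"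
          if "x \<noteq> 0" for x p R :: "rat poly fract" and m
          using that by (simp add: power_mult_distrib field_simps)
        have "indet powi (k a + 1) = indet powi k a * indet" "indet powi k a \<noteq> 0"
          using indet_neq_0 by (simp_all add: power_int_add)
        then show ?thesis
          by (simp only: * power_int_minus not_False_eq_True)
      qed
      also have "(indet powi k a) ^ f a * ?R = (\<Prod>i\<in>I. ?g (insert a A) k i)"
      proof -
        have "(\<Prod>i\<in>I - {a}. ?g (insert a A) k i) = ?R" by (intro prod.cong) auto
        then show ?thesis
          using insert assms by (subst I) (simp add: prod.insert_remove)
      qed
      finally show "P_diff_op a (\<lambda>k. \<Prod>i\<in>I. ?g A k i) k
          = (indet ^ Suc (f a) - 1) * (\<Prod>i\<in>I. ?g (insert a A) k i)" .
    qed
    then show ?case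
      using insert by (simp add: P_diff_op_scale mult_ac)
  qed simp
qed

text \<open>In the Leibniz expansion a permutation only distributes the exponents 1 to
  \<open>n\<close> among the variables, so every summand acquires the same constant while its
  exponents drop by one.\<close>

lemma fold_P_diff_op_power_det:
  "Finite_Set.fold P_diff_op (power_det 1 n) {1..n}
    = (\<lambda>k. (\<Prod>a=1..n. indet ^ a - 1) * power_det 0 n k)"
proof -
  let ?F = "\<lambda>p. Finite_Set.fold P_diff_op p {1..n}"
  have shift: "(\<Prod>i=0..<n. g i) = (\<Prod>i=1..n. g (i - 1))" for g :: "nat \<Rightarrow> rat poly fract"
    by (rule prod.reindex_bij_witness[where i = "\<lambda>i. i - 1" and j = Suc]) auto
  have power_det: "power_det e n k = (\<Sum>\<pi> | \<pi> permutes {0..<n}. signof \<pi> *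
      (\<Prod>i=1..n. (indet powi k i) ^ (\<pi> (i - 1) + e)))" for e k
  proof -
    have "(\<Prod>i=0..<n. power_mat e n (\<lambda>i. indet powi k (Suc i)) $$ (i, \<pi> i))
        = (\<Prod>i=1..n. (indet powi k i) ^ (\<pi> (i - 1) + e))" if "\<pi> permutes {0..<n}" for \<pi>
      unfolding shift
    proof (intro prod.cong refl)
      fix i assume "i \<in> {1..n}"
      then have "i - 1 < n" "\<pi> (i - 1) < n" "Suc (i - 1) = i"
        using permutes_in_image[OF that, of "i - 1"] by auto
      then show "power_mat e n (\<lambda>i. indet powi k (Suc i)) $$ (i - 1, \<pi> (i - 1))
          = (indet powi k i) ^ (\<pi> (i - 1) + e)"
        by (simp add: power_mat_def)
    qed
    then show ?thesis
      unfolding power_det_def det_def'[OF power_mat_carrier] by (intro sum.cong) auto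
  qed
  have lin: "linear_op ?F"
    by (rule linear_op_fold[OF comp_fun_commute_P_diff_op linear_op_P_diff_op]) simp
  have "power_det 1 n = (\<lambda>k. \<Sum>\<pi> | \<pi> permutes {0..<n}. signof \<pi> *
      (\<Prod>i=1..n. (indet powi k i) ^ Suc (\<pi> (i - 1))))"
    by (simp add: fun_eq_iff power_det)
  then have "?F (power_det 1 n) = (\<lambda>k. \<Sum>\<pi> | \<pi> permutes {0..<n}. signof \<pi> *
      ?F (\<lambda>k. \<Prod>i=1..n. (indet powi k i) ^ Suc (\<pi> (i - 1))) k)"
    by (simp only: linear_op_sum[OF lin finite_permutations[OF finite_atLeastLessThan]])
  also have "\<dots> = (\<lambda>k. \<Sum>\<pi> | \<pi> permutes {0..<n}. signof \<pi> *
      ((\<Prod>a=1..n. indet ^ a - 1) * (\<Prod>i=1..n. (indet powi k i) ^ \<pi> (i - 1))))"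
  proof (intro ext sum.cong refl arg_cong2[where f = times])
    fix k \<pi> assume "\<pi> \<in> {\<pi>. \<pi> permutes {0..<n}}"
    then have \<pi>: "\<pi> permutes {0..<n}" by simp
    have "(\<Prod>i=1..n. indet ^ Suc (\<pi> (i - 1)) - 1) = (\<Prod>i=0..<n. indet ^ Suc (\<pi> i) - 1)"
      by (rule shift[symmetric])
    also have "\<dots> = (\<Prod>i=0..<n. indet ^ Suc i - 1)"
      by (rule prod.permute[OF \<pi>, unfolded comp_def, symmetric])
    also have "\<dots> = (\<Prod>a=1..n. indet ^ a - 1)"
      unfolding shift by (intro prod.cong) auto
    finally show "?F (\<lambda>k. \<Prod>i=1..n. (indet powi k i) ^ Suc (\<pi> (i - 1))) k
        = (\<Prod>a=1..n. indet ^ a - 1) * (\<Prod>i=1..n. (indet powi k i) ^ \<pi> (i - 1))"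
      by (subst fold_P_diff_op_prod) simp_all
  qed
  also have "\<dots> = (\<lambda>k. (\<Prod>a=1..n. indet ^ a - 1) * power_det 0 n k)"
    by (simp add: power_det sum_distrib_left mult_ac)
  finally show ?thesis .
qed

section \<open>The normalising constant\<close>

lemma indet_power: "indet ^ i = to_fract ([:0, 1:] ^ i)"
  by (induction i) (simp_all only: power_0 power_Suc indet_conv_to_fract to_fract_mult to_fract_1)

lemma indet_power_neq: "i \<noteq> j \<Longrightarrow> indet ^ i \<noteq> indet ^ j"
proof
  assume "i \<noteq> j" "indet ^ i = indet ^ j"
  then have "to_fract ([:0, 1:] ^ i) = to_fract ([:0, 1 :: rat:] ^ j)"
    by (simp add: indet_power)
  then have "degree ([:0, 1 :: rat:] ^ i) = degree ([:0, 1 :: rat:] ^ j)" by simp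
  with \<open>i \<noteq> j\<close> show False by (simp add: degree_power_eq)
qed

definition vandermonde_const :: "nat \<Rightarrow> rat poly fract" where
  "vandermonde_const n = indet ^ ((n + 1) choose 3) / (\<Prod>j=1..n. \<Prod>i\<in>{1..<j}. indet ^ j - indet ^ i)"

lemma vandermonde_quot_eq:
  "indet ^ ((n + 1) choose 3) * vandermonde_quot n k = vandermonde_const n * power_det 0 n k"
proof -
  have "power_det 0 n k = (\<Prod>j<n. \<Prod>i<j. indet powi k (Suc j) - indet powi k (Suc i))"
    by (simp add: power_det_def det_power_mat_0)
  also have "\<dots> = (\<Prod>j=1..n. \<Prod>i\<in>{1..<j}. indet powi k j - indet powi k i)"
  proof (rule prod.reindex_bij_witness[where i = "\<lambda>i. i - 1" and j = Suc])
    fix j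
    show "(\<Prod>i\<in>{1..<Suc j}. indet powi k (Suc j) - indet powi k i)
        = (\<Prod>i<j. indet powi k (Suc j) - indet powi k (Suc i))"
      by (rule prod.reindex_bij_witness[where j = "\<lambda>i. i - 1" and i = Suc]) auto
  qed auto
  finally show ?thesis
    by (simp add: vandermonde_quot_def vandermonde_const_def prod_dividef)
qed

text \<open>The factors \<open>indet ^ i\<close> of the new denominators multiply to the power with
  exponent \<open>Suc n choose 2\<close>, which Pascal's rule also supplies in the numerator. What
  remains is the constant of \<open>fold_P_diff_op_power_det\<close>.\<close>

lemma vandermonde_const_Suc:
  "vandermonde_const n = vandermonde_const (Suc n) * (\<Prod>a=1..n. indet ^ a - 1)"
proof -
  have "(\<Prod>i\<in>{1..<Suc n}. indet ^ Suc n - indet ^ i)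
      = (\<Prod>i=1..n. indet ^ i * (indet ^ (Suc n - i) - 1))"
    by (intro prod.cong) (auto simp: right_diff_distrib simp flip: power_add)
  also have "\<dots> = indet ^ (\<Sum>i=1..n. i) * (\<Prod>i=1..n. indet ^ (Suc n - i) - 1)"
    by (simp add: prod.distrib power_sum)
  also have "(\<Prod>i=1..n. indet ^ (Suc n - i) - 1) = (\<Prod>a=1..n. indet ^ a - 1)"
    by (rule prod.reindex_bij_witness[where i = "\<lambda>i. Suc n - i" and j = "\<lambda>i. Suc n - i"]) auto
  also have "(\<Sum>i=1..n. i) = Suc n choose 2"
    using gauss_sum_nat[of n] by (simp add: choose_two atMost_atLeast0 sum.atLeast_Suc_atMost mult.commute)
  finally have "(\<Prod>i\<in>{1..<Suc n}. indet ^ Suc n - indet ^ i)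
      = indet ^ (Suc n choose 2) * (\<Prod>a=1..n. indet ^ a - 1)" .
  moreover have "(\<Prod>a=1..n. indet ^ a - 1) \<noteq> 0"
    using indet_power_neq[of _ 0] by auto
  moreover have "(Suc n + 1) choose 3 = (Suc n choose 2) + (Suc n choose 3)"
    by (simp add: numeral_3_eq_3 numeral_2_eq_2)
  moreover note indet_neq_0
  ultimately show ?thesis
    by (simp add: vandermonde_const_def power_add field_simps)
qed

subsection \<open>Splitting off the bottom row\<close>

definition triangles :: "nat \<Rightarrow> (nat \<Rightarrow> int) \<Rightarrow> (nat \<times> nat \<Rightarrow> int) set" where
  "triangles n k = {T \<in> weak_monotone_triangles n. bottom_row n k T}"

text \<open>Row \<open>i\<close> starts in column \<open>i\<close>, so removing a row shifts both
  indices.\<close>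

definition upper_rows :: "nat \<Rightarrow> (nat \<times> nat \<Rightarrow> int) \<Rightarrow> nat \<times> nat \<Rightarrow> int" where
  "upper_rows n T = restrict (\<lambda>(i, j). T (Suc i, Suc j)) (tri_index n)"

definition add_bottom_row :: "nat \<Rightarrow> (nat \<Rightarrow> int) \<Rightarrow> (nat \<times> nat \<Rightarrow> int) \<Rightarrow> nat \<times> nat \<Rightarrow> int" where
  "add_bottom_row n k T =
     restrict (\<lambda>(i, j). if i = 1 then k j else T (i - 1, j - 1)) (tri_index (Suc n))"

definition weakly_fits :: "nat \<Rightarrow> (nat \<Rightarrow> int) \<Rightarrow> (nat \<Rightarrow> int) \<Rightarrow> bool" where
  "weakly_fits n k l \<longleftrightarrow> (\<forall>j\<in>{1..<n}. l j < k (j + 2))"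

text \<open>All inequalities are attached to the same upper entry \<open>(i, j)\<close>, so they
  move together when a row is added.\<close>

lemma triangles_iff:
  "T \<in> triangles n k \<longleftrightarrow> T \<in> extensional (tri_index n) \<and>
     (\<forall>j\<in>{1..n}. T (1, j) = k j) \<and>
     (\<forall>i j. 2 \<le> i \<and> i \<le> j \<and> j \<le> n \<longrightarrow>
        T (i - 1, j - 1) \<le> T (i, j) \<and> T (i, j) \<le> T (i - 1, j) \<and>
        (i < j \<longrightarrow> T (i, j - 1) < T (i - 1, j)))" (is "_ = ?R")
proof -
  have *: "(\<forall>i j. 1 \<le> i \<and> i \<le> j \<and> j < n \<longrightarrow> T (i, j) \<le> T (i + 1, j + 1)) \<longleftrightarrow>
      (\<forall>i j. 2 \<le> i \<and> i \<le> j \<and> j \<le> n \<longrightarrow> T (i - 1, j - 1) \<le> T (i, j))" (is "?A = ?B")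
  proof
    assume A: ?A
    show ?B
    proof (intro allI impI)
      fix i j assume "2 \<le> i \<and> i \<le> j \<and> j \<le> n"
      then have "1 \<le> i - 1 \<and> i - 1 \<le> j - 1 \<and> j - 1 < n" "i - 1 + 1 = i" "j - 1 + 1 = j" by auto
      then show "T (i - 1, j - 1) \<le> T (i, j)" using A by metis
    qed
  next
    assume B: ?B
    show ?A
    proof (intro allI impI)
      fix i j assume "1 \<le> i \<and> i \<le> j \<and> j < n"
      then have "2 \<le> i + 1 \<and> i + 1 \<le> j + 1 \<and> j + 1 \<le> n" by auto
      then show "T (i, j) \<le> T (i + 1, j + 1)" using B by (metis add_diff_cancel_right')
    qed
  qed
  show ?thesis
    unfolding triangles_def weak_monotone_triangles_def GT_patterns_def bottom_row_def
      mem_Collect_eq * PiE_def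
    by (auto simp: Suc_le_eq numeral_2_eq_2)
qed

lemma add_bottom_row_upper_rows:
  assumes "T \<in> triangles (Suc n) k"
  shows "add_bottom_row n k (upper_rows n T) = T"
proof
  fix x
  show "add_bottom_row n k (upper_rows n T) x = T x"
  proof (cases "x \<in> tri_index (Suc n)")
    case True
    then obtain i j where x: "x = (i, j)" "1 \<le> i" "i \<le> j" "j \<le> Suc n" by (auto simp: tri_index_def)
    show ?thesis
    proof (cases "i = 1")
      case True
      then show ?thesis
        using x assms by (auto simp: add_bottom_row_def tri_index_def triangles_iff)
    next
      case False
      then have "(i - 1, j - 1) \<in> tri_index n" using x by (auto simp: tri_index_def)
      then show ?thesis using x False by (simp add: add_bottom_row_def upper_rows_def tri_index_def)
    qed
  next
    case False
    then show ?thesis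
      using assms extensional_arb[of T "tri_index (Suc n)" x]
      by (simp add: add_bottom_row_def triangles_iff)
  qed
qed

lemma upper_rows_add_bottom_row:
  assumes "T \<in> triangles n l"
  shows "upper_rows n (add_bottom_row n k T) = T"
proof
  fix x
  show "upper_rows n (add_bottom_row n k T) x = T x"
  proof (cases "x \<in> tri_index n")
    case True
    then show ?thesis by (auto simp: upper_rows_def add_bottom_row_def tri_index_def)
  next
    case False
    then show ?thesis
      using assms extensional_arb[of T "tri_index n" x] by (simp add: upper_rows_def triangles_iff)
  qed
qed

text \<open>Conditions from row 3 on are those of \<open>T\<close> with shifted indices; the
  conditions at row 2 amount to interlacing and the strict inequality.\<close>

lemma add_bottom_row_in_triangles_iff:
  assumes T: "T \<in> triangles n l" and l: "\<And>j. j \<notin> {1..n} \<Longrightarrow> l j = y j"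
  shows "add_bottom_row n k T \<in> triangles (Suc n) k \<longleftrightarrow> l \<in> row_box n k y \<and> weakly_fits n k l"
proof -
  let ?T = "add_bottom_row n k T"
  let ?P = "\<lambda>T i j. T (i - 1, j - 1) \<le> T (i, j) \<and> T (i, j) \<le> T (i - 1, j) \<and>
      (i < j \<longrightarrow> T (i, j - 1) < (T (i - 1, j) :: int))"
  have up: "?T (Suc i, Suc j) = T (i, j)" if "1 \<le> i" "i \<le> j" "j \<le> n" for i j
    using that by (simp add: add_bottom_row_def tri_index_def)
  have bot: "?T (1, j) = k j" if "1 \<le> j" "j \<le> Suc n" for j
    using that by (simp add: add_bottom_row_def tri_index_def)
  have row: "T (1, j) = l j" if "1 \<le> j" "j \<le> n" for j
    using T that by (auto simp: triangles_iff)
  have higher: "?P ?T (Suc i) (Suc j)" if "2 \<le> i" "i \<le> j" "j \<le> n" for i j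
  proof -
    have "?P T i j" using T that unfolding triangles_iff by blast
    moreover have "?T (i, j) = T (i - 1, j - 1)" "?T (Suc i, j) = T (i, j - 1)" if "i < j"
      using up[of "i - 1" "j - 1"] up[of i "j - 1"] that \<open>2 \<le> i\<close> \<open>j \<le> n\<close> by auto
    moreover have "?T (i, Suc j) = T (i - 1, j)" "?T (Suc i, Suc j) = T (i, j)"
        "?T (i, j) = T (i - 1, j - 1)"
      using up[of "i - 1" j] up[of i j] up[of "i - 1" "j - 1"] that by auto
    ultimately show ?thesis by auto
  qed
  have second: "?P ?T 2 (Suc j) \<longleftrightarrow> k j \<le> l j \<and> l j \<le> k (Suc j) \<and> (2 \<le> j \<longrightarrow> l (j - 1) < k (Suc j))"
    if "1 \<le> j" "j \<le> n" for j
  proof -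
    have "?T (2, Suc j) = l j" "?T (1, j) = k j" "?T (1, Suc j) = k (Suc j)"
      using up[of 1 j] row[of j] bot[of j] bot[of "Suc j"] that by (auto simp: numeral_2_eq_2)
    moreover have "?T (2, j) = l (j - 1)" if "2 \<le> j"
      using up[of 1 "j - 1"] row[of "j - 1"] that \<open>j \<le> n\<close> by (auto simp: numeral_2_eq_2)
    ultimately show ?thesis using that by auto
  qed
  have "?T \<in> triangles (Suc n) k \<longleftrightarrow> (\<forall>i j. 2 \<le> i \<and> i \<le> j \<and> j \<le> Suc n \<longrightarrow> ?P ?T i j)"
    using bot by (auto simp: triangles_iff add_bottom_row_def[of n k T])
  also have "\<dots> \<longleftrightarrow> (\<forall>j\<in>{1..n}. ?P ?T 2 (Suc j))" (is "?A = ?B")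
  proof
    assume A: ?A
    show ?B
    proof
      fix j assume "j \<in> {1..n}"
      then have "2 \<le> (2 :: nat) \<and> 2 \<le> Suc j \<and> Suc j \<le> Suc n" by auto
      then show "?P ?T 2 (Suc j)" using A by blast
    qed
  next
    assume B: ?B
    show ?A
    proof (intro allI impI)
      fix i j assume ij: "2 \<le> i \<and> i \<le> j \<and> j \<le> Suc n"
      then obtain j' where j: "j = Suc j'" by (cases j) auto
      show "?P ?T i j"
      proof (cases "i = 2")
        case True
        then show ?thesis using B[rule_format, of j'] ij j by auto
      next
        case False
        then obtain i' where "i = Suc i'" "2 \<le> i'" using ij by (cases i) auto
        then show ?thesis using higher[of i' j'] ij j by auto
      qed
    qed
  qed
  also have "\<dots> \<longleftrightarrow> (\<forall>j\<in>{1..n}. k j \<le> l j \<and> l j \<le> k (Suc j) \<and> (2 \<le> j \<longrightarrow> l (j - 1) < k (Suc j)))"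
    using second by auto
  also have "\<dots> \<longleftrightarrow> (\<forall>j\<in>{1..n}. k j \<le> l j \<and> l j \<le> k (Suc j)) \<and> (\<forall>j\<in>{2..n}. l (j - 1) < k (Suc j))"
    by auto
  also have "(\<forall>j\<in>{2..n}. l (j - 1) < k (Suc j)) \<longleftrightarrow> weakly_fits n k l"
  proof -
    have eq: "{2..n} = Suc ` {1..<n}" by (auto simp: image_Suc_atLeastLessThan)
    show ?thesis unfolding weakly_fits_def eq ball_simps by simp
  qed
  finally show ?thesis using l by (auto simp: row_box_def)
qed

lemma P_weight_eq: "P_weight n T = (\<Prod>(i, j)\<in>{(i, j). 2 \<le> i \<and> i \<le> j \<and> j \<le> n}.
    if T (i, j) < T (i - 1, j) then indet powi T (i, j) - of_bool (i < j \<and> T (i, j) = T (i, j - 1)) else 1)"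
proof -
  have fin: "finite {(i, j). 2 \<le> i \<and> i \<le> j \<and> j \<le> n}"
    by (rule finite_subset[OF _ finite_tri_index[of n]]) (auto simp: tri_index_def)
  have eq: "{(i, j). (i, j) \<in> tri_index n \<and> 2 \<le> i \<and> T (i, j) < T (i - 1, j)}
      = {x \<in> {(i, j). 2 \<le> i \<and> i \<le> j \<and> j \<le> n}. T x < T (fst x - 1, snd x)}"
    by (auto simp: tri_index_def)
  show ?thesis
    unfolding P_weight_def eq prod.inter_filter[OF fin] by (intro prod.cong) auto
qed

lemma P_weight_Suc:
  assumes T: "T \<in> triangles n l" and l: "l \<in> row_box n k y" and fits: "weakly_fits n k l"
  shows "P_weight (Suc n) (add_bottom_row n k T) = row_wt n k l * P_weight n T"
proof -
  let ?T = "add_bottom_row n k T"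
  let ?w = "\<lambda>T (i, j). if T (i, j) < T (i - 1, j)
      then indet powi T (i, j) - of_bool (i < j \<and> T (i, j) = T (i, j - 1)) else 1"
  let ?U = "\<lambda>n. {(i, j). 2 \<le> i \<and> i \<le> j \<and> j \<le> (n :: nat)}"
  have up: "?T (Suc i, Suc j) = T (i, j)" if "1 \<le> i" "i \<le> j" "j \<le> n" for i j
    using that by (simp add: add_bottom_row_def tri_index_def)
  have bot: "?T (1, j) = k j" if "1 \<le> j" "j \<le> Suc n" for j
    using that by (simp add: add_bottom_row_def tri_index_def)
  have row: "T (1, j) = l j" if "1 \<le> j" "j \<le> n" for j
    using T that by (auto simp: triangles_iff)
  have fin: "finite (?U m)" for m
    by (rule finite_subset[OF _ finite_tri_index[of m]]) (auto simp: tri_index_def)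
  have U: "?U (Suc n) = (\<lambda>j. (2, Suc j)) ` {1..n} \<union> (\<lambda>(i, j). (Suc i, Suc j)) ` ?U n"
  proof (intro subset_antisym subsetI)
    fix x assume "x \<in> ?U (Suc n)"
    then obtain i j where x: "x = (Suc i, Suc j)" "1 \<le> i" "i \<le> j" "j \<le> n"
      by (auto simp: numeral_2_eq_2 Suc_le_eq) (metis Suc_le_D Suc_le_mono less_eq_Suc_le)
    then show "x \<in> (\<lambda>j. (2, Suc j)) ` {1..n} \<union> (\<lambda>(i, j). (Suc i, Suc j)) ` ?U n"
      by (cases "i = 1") (auto simp: numeral_2_eq_2)
  qed auto
  have "P_weight (Suc n) ?T = (\<Prod>x\<in>(\<lambda>j. (2, Suc j)) ` {1..n}. ?w ?T x) *
      (\<Prod>x\<in>(\<lambda>(i, j). (Suc i, Suc j)) ` ?U n. ?w ?T x)"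
    unfolding P_weight_eq U by (rule prod.union_disjoint) (use fin in auto)
  also have "(\<Prod>x\<in>(\<lambda>j. (2, Suc j)) ` {1..n}. ?w ?T x) = (\<Prod>j=1..n. ?w ?T (2, Suc j))"
    by (subst prod.reindex) (auto simp: inj_on_def)
  also have "\<dots> = row_wt n k l"
    unfolding row_wt_def
  proof (intro prod.cong refl)
    fix j assume j: "j \<in> {1..n}"
    have v: "?T (2, Suc j) = l j" "?T (1, Suc j) = k (Suc j)"
      using up[of 1 j] row[of j] bot[of "Suc j"] j by (auto simp: numeral_2_eq_2)
    have v': "?T (2, j) = l (j - 1)" if "2 \<le> j"
      using up[of 1 "j - 1"] row[of "j - 1"] that j by (auto simp: numeral_2_eq_2)
    \<comment> \<open>In case of equality \<open>P_weight\<close> skips the entry, and the strict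
      inequality excludes \<open>l j = l (j - 1)\<close>, so the factor of \<open>row_wt\<close> is
      1 too.\<close>
    have "l j \<le> k (Suc j)" using l j by (auto simp: row_box_def)
    moreover have "l (j - 1) < k (Suc j)" if "2 \<le> j"
      using fits that j by (auto simp: weakly_fits_def dest!: bspec[of _ _ "j - 1"])
    ultimately show "?w ?T (2, Suc j) = step_wt k j (l j) - of_bool (2 \<le> j \<and> l j = l (j - 1))"
      using v v' by (auto simp: step_wt_def)
  qed
  also have "(\<Prod>x\<in>(\<lambda>(i, j). (Suc i, Suc j)) ` ?U n. ?w ?T x) = (\<Prod>x\<in>?U n. ?w T x)"
  proof (subst prod.reindex)
    show "prod (?w ?T \<circ> (\<lambda>(i, j). (Suc i, Suc j))) (?U n) = prod (?w T) (?U n)"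
    proof (intro prod.cong refl)
      fix x assume "x \<in> ?U n"
      then obtain i j where x: "x = (i, j)" "2 \<le> i" "i \<le> j" "j \<le> n" by auto
      have "?T (Suc i, Suc j) = T (i, j)" "?T (i, Suc j) = T (i - 1, j)"
        using up[of i j] up[of "i - 1" j] x by auto
      moreover have "?T (Suc i, j) = T (i, j - 1)" if "i < j"
        using up[of i "j - 1"] x that by auto
      ultimately show "(?w ?T \<circ> (\<lambda>(i, j). (Suc i, Suc j))) x = ?w T x"
        using x by (auto simp: of_bool_def)
    qed
  qed (auto simp: inj_on_def)
  finally show ?thesis by (simp add: P_weight_eq)
qed

section \<open>Recursion for the generating function and the final induction\<close>

definition tri_gf :: "nat \<Rightarrow> func" where
  "tri_gf n k = (\<Sum>T\<in>triangles n k. P_weight n T)"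

text \<open>A violation at \<open>j\<close> squeezes \<open>l j\<close> and \<open>l (Suc j)\<close>
  to the value \<open>k (j + 2)\<close>, and the factor at \<open>Suc j\<close> is 1 - 1.\<close>

lemma row_wt_not_weakly_fits:
  assumes "l \<in> row_box n k y" "\<not> weakly_fits n k l"
  shows "row_wt n k l = 0"
proof -
  obtain j where j: "1 \<le> j" "j < n" "k (j + 2) \<le> l j"
    using assms(2) by (auto simp: weakly_fits_def not_less)
  have "l j \<le> k (Suc j)" "k (Suc j) \<le> l (Suc j)" "l (Suc j) \<le> k (Suc (Suc j))"
    using assms(1) j by (auto simp: row_box_def)
  then have "step_wt k (Suc j) (l (Suc j)) - of_bool (2 \<le> Suc j \<and> l (Suc j) = l (Suc j - 1)) = 0"
    using j by (simp add: step_wt_def)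
  then show ?thesis
    unfolding row_wt_def using j by (intro prod_zero) (auto intro!: bexI[of _ "Suc j"])
qed

lemma tri_gf_Suc: "tri_gf (Suc n) k = (\<Sum>l\<in>row_box n k y. row_wt n k l * tri_gf n l)"
proof -
  let ?B = "{l \<in> row_box n k y. weakly_fits n k l}"
  let ?row = "\<lambda>T j. if j \<in> {1..n} then T (2, Suc j) else y j"
  have fin: "finite ?B" by (simp add: finite_row_box)
  have fin': "finite (triangles n l)" for l
    by (simp add: triangles_def finite_weak_monotone_triangles)
  have upper: "upper_rows n T \<in> triangles n (?row T)" if "T \<in> triangles (Suc n) k" for T
    unfolding triangles_iff
  proof (intro conjI allI impI ballI)
    fix i j assume ij: "2 \<le> i \<and> i \<le> j \<and> j \<le> n"
    have val: "upper_rows n T (i, j) = T (Suc i, Suc j)" "upper_rows n T (i - 1, j) = T (i, Suc j)"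
        "upper_rows n T (i - 1, j - 1) = T (i, j)"
        "i < j \<Longrightarrow> upper_rows n T (i, j - 1) = T (Suc i, j)"
      using ij by (auto simp: upper_rows_def tri_index_def)
    have "2 \<le> Suc i \<and> Suc i \<le> Suc j \<and> Suc j \<le> Suc n" using ij by auto
    then have "T (Suc i - 1, Suc j - 1) \<le> T (Suc i, Suc j) \<and> T (Suc i, Suc j) \<le> T (Suc i - 1, Suc j) \<and>
        (Suc i < Suc j \<longrightarrow> T (Suc i, Suc j - 1) < T (Suc i - 1, Suc j))"
      using that unfolding triangles_iff by blast
    then show "upper_rows n T (i - 1, j - 1) \<le> upper_rows n T (i, j)"
      "upper_rows n T (i, j) \<le> upper_rows n T (i - 1, j)"
      "i < j \<Longrightarrow> upper_rows n T (i, j - 1) < upper_rows n T (i - 1, j)"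
      using val by auto
  qed (auto simp: upper_rows_def tri_index_def numeral_2_eq_2)
  have "tri_gf (Suc n) k = (\<Sum>(l, T)\<in>Sigma ?B (triangles n). row_wt n k l * P_weight n T)"
    unfolding tri_gf_def
  proof (rule sum.reindex_bij_witness[where i = "\<lambda>(l, T). add_bottom_row n k T"
        and j = "\<lambda>T. (?row T, upper_rows n T)"])
    fix T assume T: "T \<in> triangles (Suc n) k"
    let ?T' = "upper_rows n T" and ?l = "?row T"
    have eq: "add_bottom_row n k ?T' = T"
      using T by (rule add_bottom_row_upper_rows)
    have l0: "?l j = y j" if "j \<notin> {1..n}" for j using that by (rule if_not_P)
    have l: "?l \<in> row_box n k y" "weakly_fits n k ?l"
      using add_bottom_row_in_triangles_iff[OF upper[OF T] l0, of k] T unfolding eq by blast+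
    show "(case (?l, ?T') of (l, T) \<Rightarrow> add_bottom_row n k T) = T" using eq by simp
    show "(?l, ?T') \<in> Sigma ?B (triangles n)" using l upper[OF T] by auto
    show "(case (?l, ?T') of (l, T) \<Rightarrow> row_wt n k l * P_weight n T) = P_weight (Suc n) T"
      using P_weight_Suc[OF upper[OF T] l] eq by simp
  next
    fix x assume x: "x \<in> Sigma ?B (triangles n)"
    then obtain l T where lT: "x = (l, T)" "l \<in> row_box n k y" "weakly_fits n k l" "T \<in> triangles n l"
      by auto
    show "(case x of (l, T) \<Rightarrow> add_bottom_row n k T) \<in> triangles (Suc n) k"
      using lT add_bottom_row_in_triangles_iff[OF lT(4) row_box_outside[OF lT(2)]] by auto
    have "?row (add_bottom_row n k T) = l"
    proof
      fix j
      show "?row (add_bottom_row n k T) j = l j"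
        using lT(4) row_box_outside[OF lT(2), of j]
        by (auto simp: add_bottom_row_def tri_index_def triangles_iff numeral_2_eq_2)
    qed
    then show "(?row (case x of (l, T) \<Rightarrow> add_bottom_row n k T),
        upper_rows n (case x of (l, T) \<Rightarrow> add_bottom_row n k T)) = x"
      unfolding lT(1) prod.case upper_rows_add_bottom_row[OF lT(4)] by simp
  qed
  also have "\<dots> = (\<Sum>l\<in>?B. row_wt n k l * tri_gf n l)"
    using fin fin' by (subst sum.Sigma[symmetric]) (auto simp: tri_gf_def sum_distrib_left)
  also have "\<dots> = (\<Sum>l\<in>row_box n k y. row_wt n k l * tri_gf n l)"
    by (rule sum.mono_neutral_left) (auto simp: finite_row_box dest: row_wt_not_weakly_fits)
  finally show ?thesis .
qed

lemma tri_gf_0: "tri_gf 0 k = 1"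
proof -
  have "triangles 0 k = {\<lambda>x. undefined}"
    by (auto simp: triangles_iff tri_index_def extensional_def)
  then show ?thesis by (simp add: tri_gf_def P_weight_eq)
qed

text \<open>Every row above such a bottom row has weight zero. This settles the triple coincidences
  that \<open>row_wt_eq_pair_wt\<close> excludes.\<close>

lemma tri_gf_eq_0:
  assumes "1 \<le> j" "j + 2 \<le> n" "l j = l (j + 1)" "l (j + 1) = l (j + 2)"
  shows "tri_gf n l = 0"
proof (cases n)
  case (Suc m)
  then show ?thesis
    unfolding Suc tri_gf_Suc[of m l l]
  proof (intro sum.neutral ballI)
    fix x assume "x \<in> row_box m l l"
    then have "row_wt m l x = 0"
      by (rule row_wt_eq_0[of x m l l j]) (use assms Suc in auto)
    then show "row_wt m l x * tri_gf m x = 0" by simp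
  qed
qed (use assms in simp)

lemma tri_gf_eq:
  assumes "mono_on {1..n} k"
  shows "tri_gf n k = vandermonde_const n * op_prod n (power_det 0 n) k"
  using assms
proof (induction n arbitrary: k)
  case 0
  show ?case
    by (simp add: tri_gf_0 vandermonde_const_def op_prod_def power_det_def power_mat_def det_def numeral_3_eq_3)
next
  case (Suc n)
  \<comment> \<open>Outside \<open>{1..n}\<close> all \<open>k \<circ> skip r\<close> with
    \<open>r\<close> in \<open>{1..Suc n}\<close> agree, so this one \<open>y\<close> serves every
    boundary term.\<close>
  define y where "y = k \<circ> skip (Suc n)"
  define c where "c = vandermonde_const (Suc n)"
  \<comment> \<open>An antiderivative of the inductive formula: differencing in all \<open>n\<close>
    variables turns the constant for \<open>Suc n\<close> into that for \<open>n\<close>.\<close>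
  define B where "B = op_prod n (\<lambda>k. c * power_det 1 n k)"
  have k: "k j \<le> k (Suc j)" if "j \<in> {1..n}" for j
    using that by (intro mono_onD[OF Suc.prems]) auto
  have lin_D: "linear_op (\<lambda>p. Finite_Set.fold P_diff_op p {1..n})"
    by (rule linear_op_fold[OF comp_fun_commute_P_diff_op linear_op_P_diff_op]) simp
  have A: "Finite_Set.fold P_diff_op B {1..n} = (\<lambda>l. vandermonde_const n * op_prod n (power_det 0 n) l)"
  proof -
    have eq: "Finite_Set.fold P_diff_op (\<lambda>k. c * power_det 1 n k) {1..n}
        = (\<lambda>k. vandermonde_const n * power_det 0 n k)"
      by (subst linear_op_scale[OF lin_D])
        (simp only: fold_P_diff_op_power_det vandermonde_const_Suc[of n] c_def mult.assoc)
    show ?thesis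
      unfolding B_def fold_P_diff_op_op_prod[OF finite_atLeastAtMost] eq
      by (rule linear_op_scale[OF linear_op_op_prod])
  qed
  have "tri_gf (Suc n) k = (\<Sum>l\<in>row_box n k y. pair_wt n k l * Finite_Set.fold P_diff_op B {1..n} l)"
    unfolding tri_gf_Suc[of n k y]
  proof (intro sum.cong refl)
    fix l assume l: "l \<in> row_box n k y"
    \<comment> \<open>Interlacing makes \<open>l\<close> weakly increasing, so the induction
      hypothesis applies to it.\<close>
    have "mono_on {1..n} l"
    proof (rule mono_onI)
      fix i j assume "i \<in> {1..n}" "j \<in> {1..n}" "i \<le> j"
      show "l i \<le> l j"
      proof (cases "i = j")
        case False
        then have "l i \<le> k (Suc i)" "k (Suc i) \<le> k j" "k j \<le> l j"
          using l \<open>i \<in> {1..n}\<close> \<open>j \<in> {1..n}\<close> \<open>i \<le> j\<close>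
          by (auto simp: row_box_def intro: mono_onD[OF Suc.prems])
        then show ?thesis by simp
      qed simp
    qed
    then have gf: "tri_gf n l = Finite_Set.fold P_diff_op B {1..n} l"
      unfolding A by (rule Suc.IH)
    show "row_wt n k l * tri_gf n l = pair_wt n k l * Finite_Set.fold P_diff_op B {1..n} l"
    proof (cases "\<exists>j\<ge>1. j + 2 \<le> n \<and> l j = l (j + 1) \<and> l (j + 1) = l (j + 2)")
      case True
      then show ?thesis using gf by (metis tri_gf_eq_0 mult_zero_right)
    next
      case False
      then have "row_wt n k l = pair_wt n k l"
        by (intro row_wt_eq_pair_wt[OF l]) auto
      then show ?thesis by (simp add: gf)
    qed
  qed
  also have "\<dots> = edge_sum n k B y"
  proof -
    have "box_sum n k (Finite_Set.fold P_diff_op B {1..n}) = edge_sum n k B"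
    proof (rule box_sum_eq_edge_sum)
      fix i and y :: "nat \<Rightarrow> int" assume "1 \<le> i" "Suc i \<le> n" "y i = y (Suc i)"
      then show "op_factor (Suc i) i B y = 0"
        unfolding B_def by (intro op_factor_op_prod_eq_0) (auto simp: power_det_swap)
    qed (use k in auto)
    from fun_cong[OF this, of y] show ?thesis by (simp only: box_sum_def)
  qed
  also have "\<dots> = (\<Sum>r=1..Suc n. (- 1) ^ (r - 1) * Finite_Set.fold P_shift_op B {r..n} (k \<circ> skip r))"
    unfolding edge_sum_unfold
  proof (intro sum.cong refl arg_cong2[where f = times] arg_cong[where f = "Finite_Set.fold P_shift_op B _"])
    fix r assume "r \<in> {1..Suc n}"
    then show "(\<lambda>j. if j \<in> {1..n} then k (skip r j) else y j) = k \<circ> skip r"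
      by (auto simp: y_def skip_def fun_eq_iff)
  qed
  also have "\<dots> = (\<Sum>r=1..Suc n. (- 1) ^ (r - 1) *
      op_prod (Suc n) (relabel (skip r) (\<lambda>k. c * power_det 1 n k)) k)"
  proof (intro sum.cong refl arg_cong2[where f = times])
    fix r assume "r \<in> {1..Suc n}"
    then have r: "1 \<le> r" "r \<le> Suc n" by auto
    show "Finite_Set.fold P_shift_op B {r..n} (k \<circ> skip r)
        = op_prod (Suc n) (relabel (skip r) (\<lambda>k. c * power_det 1 n k)) k"
      unfolding op_prod_relabel_skip[OF r] B_def by (simp only: relabel_def)
  qed
  also have "\<dots> = op_prod (Suc n) (\<lambda>k. \<Sum>r=1..Suc n. (- 1) ^ (r - 1) *
      relabel (skip r) (\<lambda>k. c * power_det 1 n k) k) k"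
    by (simp only: linear_op_sum[OF linear_op_op_prod finite_atLeastAtMost])
  \<comment> \<open>The alternating sum over the omitted variable is the expansion of
    \<open>power_det 0 (Suc n)\<close> along its column of ones.\<close>
  also have "(\<lambda>k. \<Sum>r=1..Suc n. (- 1) ^ (r - 1) * relabel (skip r) (\<lambda>k. c * power_det 1 n k) k)
      = (\<lambda>k. c * power_det 0 (Suc n) k)"
    unfolding power_det_expand_column relabel_def sum_distrib_left
    by (intro ext sum.cong refl) (simp add: mult_ac)
  finally show ?case
    by (simp add: linear_op_scale[OF linear_op_op_prod] c_def)
qed

theorem theorem2:
  fixes n :: nat and k :: "nat \<Rightarrow> int"
  assumes "n \<ge> 1"
    and "mono_on {1..n} k"
  shows "(\<Sum>T\<in>{T \<in> weak_monotone_triangles n. bottom_row n k T}. P_weight n T) =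
    indet ^ ((n + 1) choose 3) * op_prod n (vandermonde_quot n) k"
proof -
  have "indet ^ ((n + 1) choose 3) * op_prod n (vandermonde_quot n) k
      = op_prod n (\<lambda>k. indet ^ ((n + 1) choose 3) * vandermonde_quot n k) k"
    by (simp only: linear_op_scale[OF linear_op_op_prod])
  also have "\<dots> = vandermonde_const n * op_prod n (power_det 0 n) k"
    by (simp only: vandermonde_quot_eq linear_op_scale[OF linear_op_op_prod])
  also have "\<dots> = tri_gf n k"
    using tri_gf_eq[OF assms(2)] by simp
  finally show ?thesis
    by (simp only: tri_gf_def triangles_def)
qed

end
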